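(* Let $\mathcal P$ be a hereditary permutation property and let $\epsilon>0$. Let $$M=\left\lceil\frac{20000}{\epsilon^2}\right\rceil,\qquad n_0=\frac{32M^5k^*(M)}{\epsilon^3}.$$ Then there is a two-sided tester for $\mathcal P$ with respect to the planar tau distance, with parameter $\epsilon$ and query complexity $M$, for permutations of length at least $n_0$.
   Context: A permutation $\pi$ of length $n=|\pi|\ge1$ is a bijection $[n]\to[n]$, $[n]=\{1,\dots,n\}$. A permutation $\sigma$ of length $k$ is a subpermutation of $\pi$ if there are $i_1<\dots<i_k$ in $[n]$ with $\pi(i_j)<\pi(i_\ell)$ iff $\sigma(j)<\sigma(\ell)$. A permutation property is a family $\mathcal P$ of permutations; it is hereditary if every subpermutation of a member is a member. Blow-ups. A permutation $\alpha'$ is a blow-up of $\alpha$ if there are integers $1=k_1<k_2<\dots<k_{|\alpha|+1}=|\alpha'|+1$ such that whenever $k_{j_1}\le i_1<k_{j_1+1}$ and $k_{j_2}\le i_2<k_{j_2+1}$ with $j_1\ne j_2$, one has $\alpha'(i_1)>\alpha'(i_2)$ iff $\alpha(j_1)>\alpha(j_2)$. The $j$-th block has size $k_{j+1}-k_j$; the pattern inside each block is arbitrary. A $k$-blow-up is a blow-up in which every block has size $k$. For a permutation $\alpha$, $k^*(\alpha)$ is the least positive integer $k$ such that no $k$-blow-up of $\alpha$ is in $\mathcal P$, and $k^*(\alpha)=\infty$ if there is none. For a positive integer $T$, $k^*(T)$ is the maximum of $k^*(\alpha)$ over permutations $\alpha$ of length $T$ with $k^*(\alpha)<\infty$, and $k^*(T)=\infty$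 if there is no such $\alpha$. (If $n_0=\infty$ the assertion is vacuous.) Planar tau distance. $\sigma$ is obtained from $\pi$ (both of length $n$) by a planar simple transposition if for some $1\le i\le n-1$ either $\sigma$ equals $\pi$ except $\sigma(i)=\pi(i+1)$, $\sigma(i+1)=\pi(i)$, or $\sigma^{-1}$ equals $\pi^{-1}$ except $\sigma^{-1}(i)=\pi^{-1}(i+1)$, $\sigma^{-1}(i+1)=\pi^{-1}(i)$. $\rho_{\mathrm{PT}}(\pi_1,\pi_2)$ is $1/\binom n2$ times the minimum number of planar simple transpositions transforming $\pi_1$ into $\pi_2$ (and $0$ if $n=1$). The distance of $\pi$ from $\mathcal P$ is $\min\rho_{\mathrm{PT}}(\pi,\pi_0)$ over $\pi_0\in\mathcal P$ with $|\pi_0|=|\pi|$, and is $1$ if there is no such $\pi_0$; $\pi$ is $\epsilon$-far from $\mathcal P$ if this distance is greater than $\epsilon$. Testers. A two-sided tester for $\mathcal P$ (with parameter $\epsilon$) of query complexity $q$, for permutations of length at least $n_0$, is a randomized algorithm (which may depend on $\mathcal P$ and $\epsilon$; only queries are counted) that, for each permutation $\pi$ of length $n\ge n_0$, queries at most $q$ positions of $\pi$ and outputs either "$\pi\in\mathcal P$" or "$\pi\notin\mathcal P$", such that: if $\pi\in\mathcal P$ it outputs "$\pi\in\mathcal P$" with probability at least $2/3$, and if $\pi$ is $\epsilon$-far from $\mathcal P$ it outputs "$\pi\notin\mathcal P$" with probability at least $2/3$. *)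

theory Defs
  imports "HOL-Probability.Probability" "HOL-Combinatorics.Permutations"
begin

section \<open>Permutation properties\<close>

text \<open>A permutation of length \<open>n\<close> is a pair \<open>(n, \<pi>)\<close> with \<open>\<pi> permutes {1..n}\<close>. Since such
  a \<open>\<pi>\<close> is the identity outside \<open>{1..n}\<close>, each bijection of \<open>[n]\<close> has exactly one representative.\<close>

type_synonym perm = "nat \<Rightarrow> nat"

definition permutations :: "(nat \<times> perm) set" where
  "permutations = {(n, \<pi>). n \<ge> 1 \<and> \<pi> permutes {1..n}}"

definition subpermutation :: "nat \<Rightarrow> perm \<Rightarrow> nat \<Rightarrow> perm \<Rightarrow> bool" where
  "subpermutation k \<sigma> n \<pi> \<longleftrightarrow>
     (\<exists>i :: nat \<Rightarrow> nat. strict_mono_on {1..k} i \<and> i ` {1..k} \<subseteq> {1..n} \<and>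
        (\<forall>j\<in>{1..k}. \<forall>l\<in>{1..k}. \<pi> (i j) < \<pi> (i l) \<longleftrightarrow> \<sigma> j < \<sigma> l))"

definition permutation_property :: "(nat \<times> perm) set \<Rightarrow> bool" where
  "permutation_property P \<longleftrightarrow> P \<subseteq> permutations"

definition hereditary :: "(nat \<times> perm) set \<Rightarrow> bool" where
  "hereditary P \<longleftrightarrow>
     (\<forall>n \<pi> k \<sigma>. (n, \<pi>) \<in> P \<and> (k, \<sigma>) \<in> permutations \<and> subpermutation k \<sigma> n \<pi> \<longrightarrow> (k, \<sigma>) \<in> P)"

section \<open>Blow-ups\<close>

text \<open>\<open>\<alpha>'\<close> (of length \<open>m'\<close>) is a blow-up of \<open>\<alpha>\<close> (of length \<open>m\<close>) with block boundaries
  \<open>K 1 < \<dots> < K (m + 1)\<close>; the \<open>j\<close>-th block is \<open>{K j..<K (j + 1)}\<close>.\<close>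

definition blow_up_with :: "(nat \<Rightarrow> nat) \<Rightarrow> nat \<Rightarrow> perm \<Rightarrow> nat \<Rightarrow> perm \<Rightarrow> bool" where
  "blow_up_with K m \<alpha> m' \<alpha>' \<longleftrightarrow>
     K 1 = 1 \<and> K (m + 1) = m' + 1 \<and> strict_mono_on {1..m + 1} K \<and>
     (\<forall>j1\<in>{1..m}. \<forall>j2\<in>{1..m}. \<forall>i1\<in>{K j1..<K (j1 + 1)}. \<forall>i2\<in>{K j2..<K (j2 + 1)}.
        j1 \<noteq> j2 \<longrightarrow> (\<alpha>' i1 > \<alpha>' i2 \<longleftrightarrow> \<alpha> j1 > \<alpha> j2))"

definition k_blow_up :: "nat \<Rightarrow> nat \<Rightarrow> perm \<Rightarrow> nat \<Rightarrow> perm \<Rightarrow> bool" where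
  "k_blow_up k m \<alpha> m' \<alpha>' \<longleftrightarrow>
     (\<exists>K. blow_up_with K m \<alpha> m' \<alpha>' \<and> (\<forall>j\<in>{1..m}. K (j + 1) - K j = k))"

definition no_k_blow_up_in :: "(nat \<times> perm) set \<Rightarrow> nat \<Rightarrow> nat \<Rightarrow> perm \<Rightarrow> bool" where
  "no_k_blow_up_in P k m \<alpha> \<longleftrightarrow>
     (\<forall>(m', \<alpha>')\<in>permutations. k_blow_up k m \<alpha> m' \<alpha>' \<longrightarrow> (m', \<alpha>') \<notin> P)"

definition k_star_perm :: "(nat \<times> perm) set \<Rightarrow> nat \<Rightarrow> perm \<Rightarrow> enat" where
  "k_star_perm P m \<alpha> =
     (if \<exists>k\<ge>1. no_k_blow_up_in P k m \<alpha>
      then enat (LEAST k. k \<ge> 1 \<and> no_k_blow_up_in P k m \<alpha>) else \<infinity>)"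

definition k_star :: "(nat \<times> perm) set \<Rightarrow> nat \<Rightarrow> enat" where
  "k_star P T =
     (let S = {k_star_perm P T \<alpha> | \<alpha>. (T, \<alpha>) \<in> permutations \<and> k_star_perm P T \<alpha> < \<infinity>}
      in if S = {} then \<infinity> else Max S)"

section \<open>Planar tau distance\<close>

text \<open>Both arguments are required to be permutations: \<open>inv \<sigma>\<close> is the inverse function only then.\<close>

definition planar_transposition :: "nat \<Rightarrow> perm \<Rightarrow> perm \<Rightarrow> bool" where
  "planar_transposition n \<pi> \<sigma> \<longleftrightarrow>
     \<pi> permutes {1..n} \<and> \<sigma> permutes {1..n} \<and>
     (\<exists>i. 1 \<le> i \<and> i + 1 \<le> n \<and>
        (\<sigma> = \<pi>(i := \<pi> (i + 1), i + 1 := \<pi> i) \<or>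
         inv \<sigma> = (inv \<pi>)(i := inv \<pi> (i + 1), i + 1 := inv \<pi> i)))"

definition rho_PT :: "nat \<Rightarrow> perm \<Rightarrow> perm \<Rightarrow> real" where
  "rho_PT n \<pi>\<^sub>1 \<pi>\<^sub>2 =
     (if n = 1 then 0
      else real (LEAST t. (planar_transposition n ^^ t) \<pi>\<^sub>1 \<pi>\<^sub>2) / real (n choose 2))"

definition dist_PT :: "(nat \<times> perm) set \<Rightarrow> nat \<Rightarrow> perm \<Rightarrow> real" where
  "dist_PT P n \<pi> =
     (if \<exists>\<pi>\<^sub>0. (n, \<pi>\<^sub>0) \<in> P then Min {rho_PT n \<pi> \<pi>\<^sub>0 | \<pi>\<^sub>0. (n, \<pi>\<^sub>0) \<in> P} else 1)"

definition far_PT :: "real \<Rightarrow> (nat \<times> perm) set \<Rightarrow> nat \<Rightarrow> perm \<Rightarrow> bool" where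
  "far_PT \<epsilon> P n \<pi> \<longleftrightarrow> dist_PT P n \<pi> > \<epsilon>"

section \<open>Testers\<close>

text \<open>A deterministic adaptive query algorithm. \<open>Query i c\<close> asks for the value at position \<open>i\<close> and
  continues with \<open>c\<close> applied to the answer; \<open>Output True\<close> stands for the verdict that the
  permutation is in the property, \<open>Output False\<close> for the verdict that it is not.\<close>

datatype query_alg = Output bool | Query nat "nat \<Rightarrow> query_alg"

primrec verdict :: "perm \<Rightarrow> query_alg \<Rightarrow> bool" where
  "verdict \<pi> (Output b) = b"
| "verdict \<pi> (Query i c) = verdict \<pi> (c (\<pi> i))"

primrec queries :: "perm \<Rightarrow> query_alg \<Rightarrow> nat list" where
  "queries \<pi> (Output b) = []"
| "queries \<pi> (Query i c) = i # queries \<pi> (c (\<pi> i))"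

text \<open>A randomized algorithm is given the length \<open>n\<close> for free and runs a query algorithm drawn from
  the distribution \<open>A n\<close>, so that all coins are tossed before the first query. The threshold \<open>n\<^sub>0\<close>
  may be a non-integer or infinite.\<close>

definition two_sided_tester ::
    "(nat \<times> perm) set \<Rightarrow> real \<Rightarrow> nat \<Rightarrow> ereal \<Rightarrow> (nat \<Rightarrow> query_alg pmf) \<Rightarrow> bool" where
  "two_sided_tester P \<epsilon> q n\<^sub>0 A \<longleftrightarrow>
     (\<forall>(n, \<pi>)\<in>permutations. ereal (real n) \<ge> n\<^sub>0 \<longrightarrow>
        (\<forall>a\<in>set_pmf (A n). set (queries \<pi> a) \<subseteq> {1..n} \<and> length (queries \<pi> a) \<le> q) \<and>
        ((n, \<pi>) \<in> P \<longrightarrow> measure_pmf.prob (A n) {a. verdict \<pi> a} \<ge> 2 / 3) \<and>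
        (far_PT \<epsilon> P n \<pi> \<longrightarrow> measure_pmf.prob (A n) {a. \<not> verdict \<pi> a} \<ge> 2 / 3))"

end

theory Submission
  imports Defs
begin

text \<open>The tester samples \<open>m = \<lceil>M / 2\<rceil>\<close> positions and accepts iff the pattern of the sample embeds
  into a permutation \<open>\<beta>\<close> of length \<open>M\<close> with \<open>k\<^sup>*(\<beta>) = \<infinity>\<close>.

  If it accepts, then \<open>\<P>\<close> contains blow-ups of the sample pattern with arbitrary block sizes. Assign
  each point \<open>(p, \<pi> p)\<close> to its nearest sample point, and take as block sizes the numbers of points
  assigned. The resulting member of \<open>\<P>\<close> is reached from \<open>\<pi>\<close> by bubble sort on positions and values,
  at a cost of at most four times the total distance to the sample. At scale \<open>s\<close> there are
  \<open>O(n\<^sup>2 / s\<^sup>2)\<close> boxes of side \<open>s\<close>, so in expectation \<open>O(n\<^sup>3 / (s\<^sup>2 m))\<close> points lie in a box missed by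
  the sample; summing over \<open>s\<close> gives an expected distance \<open>O(n\<^sup>2 / \<surd>m)\<close>, with no logarithm because
  the block sizes are free.

  If \<open>\<pi> \<in> \<P>\<close>, cut \<open>[n]\<^sup>2\<close> into a grid of about \<open>3 M\<^sup>2 \<times> 3 M\<^sup>2\<close> boxes. With probability at least \<open>2/3\<close> the
  sample uses distinct rows and columns and only boxes with at least \<open>k\<^sup>*(M)\<close> points, and such a
  sample extends greedily to \<open>M\<close> such points. Their pattern \<open>\<beta>\<close> has a \<open>k\<^sup>*(M)\<close>-blow-up inside \<open>\<pi>\<close>,
  hence \<open>k\<^sup>*(\<beta>) = \<infinity>\<close>. Sampling only half of the \<open>M\<close> allowed positions is what makes the given
  \<open>n\<^sub>0\<close> large enough when \<open>\<epsilon>\<close> is close to 1.\<close>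

section \<open>Patterns\<close>

definition rank_in :: "('a \<Rightarrow> nat) \<Rightarrow> 'a set \<Rightarrow> 'a \<Rightarrow> nat" where
  "rank_in f X x = card {y \<in> X. f y \<le> f x}"

lemma rank_in_less_iff:
  assumes "finite X" "x \<in> X" "y \<in> X"
  shows "rank_in f X x < rank_in f X y \<longleftrightarrow> f x < f y"
proof -
  have *: "rank_in f X x < rank_in f X y" if "f x < f y" "y \<in> X" for x y
  proof -
    have "{z \<in> X. f z \<le> f x} \<subset> {z \<in> X. f z \<le> f y}"
    proof
      show "{z \<in> X. f z \<le> f x} \<subseteq> {z \<in> X. f z \<le> f y}" using that by auto
      have "y \<in> {z \<in> X. f z \<le> f y}" "y \<notin> {z \<in> X. f z \<le> f x}" using that by auto
      then show "{z \<in> X. f z \<le> f x} \<noteq> {z \<in> X. f z \<le> f y}" by metis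
    qed
    then show ?thesis unfolding rank_in_def using assms(1) by (intro psubset_card_mono) auto
  qed
  have "rank_in f X y \<le> rank_in f X x" if "f y \<le> f x"
    unfolding rank_in_def using assms(1) that by (intro card_mono) auto
  with *[of x y] assms show ?thesis by (meson leD not_le_imp_less)
qed

lemma bij_betw_rank_in:
  assumes "finite X" "inj_on f X"
  shows "bij_betw (rank_in f X) X {1..card X}"
proof -
  have inj: "inj_on (rank_in f X) X"
  proof (rule inj_onI)
    fix x y assume xy: "x \<in> X" "y \<in> X" "rank_in f X x = rank_in f X y"
    then have "f x = f y"
      using rank_in_less_iff[OF assms(1) xy(1,2), of f] rank_in_less_iff[OF assms(1) xy(2,1), of f] by auto
    then show "x = y" using assms(2) xy by (auto dest: inj_onD)
  qed
  have "rank_in f X ` X \<subseteq> {1..card X}"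
  proof
    fix r assume "r \<in> rank_in f X ` X"
    then obtain x where x: "x \<in> X" "r = card {y \<in> X. f y \<le> f x}" by (auto simp: rank_in_def)
    have "{y \<in> X. f y \<le> f x} \<noteq> {}" using x by auto
    then have "0 < r" using assms(1) x by (simp add: card_gt_0_iff)
    moreover have "r \<le> card X" unfolding x(2) using assms(1) by (intro card_mono) auto
    ultimately show "r \<in> {1..card X}" by auto
  qed
  then have "rank_in f X ` X = {1..card X}"
    by (intro card_subset_eq) (auto simp: card_image[OF inj])
  with inj show ?thesis by (auto simp: bij_betw_def)
qed

lemma pattern_exists:
  fixes X :: "nat set"
  assumes "finite X" "X \<noteq> {}" "inj_on \<pi> X"
  obtains \<sigma> where "(card X, \<sigma>) \<in> permutations"
    "\<And>x. x \<in> X \<Longrightarrow> \<sigma> (rank_in (\<lambda>x. x) X x) = rank_in \<pi> X x"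
proof -
  define e where "e = rank_in (\<lambda>x. x) X"
  have e: "bij_betw e X {1..card X}" unfolding e_def using assms by (intro bij_betw_rank_in) auto
  have b: "bij_betw (rank_in \<pi> X \<circ> the_inv_into X e) {1..card X} {1..card X}"
    by (rule bij_betw_trans[OF bij_betw_the_inv_into[OF e] bij_betw_rank_in[OF assms(1,3)]])
  define \<sigma> where "\<sigma> i = (if i \<in> {1..card X} then rank_in \<pi> X (the_inv_into X e i) else i)" for i
  have "bij_betw \<sigma> {1..card X} {1..card X}"
    using b by (subst bij_betw_cong[where g = "rank_in \<pi> X \<circ> the_inv_into X e"]) (auto simp: \<sigma>_def)
  then have "\<sigma> permutes {1..card X}" by (rule bij_imp_permutes) (auto simp: \<sigma>_def)
  moreover have "card X \<ge> 1" using assms by (simp add: Suc_leI card_gt_0_iff)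
  moreover have "\<sigma> (e x) = rank_in \<pi> X x" if "x \<in> X" for x
    using that e by (auto simp: \<sigma>_def bij_betw_def the_inv_into_f_f)
  ultimately show ?thesis using that unfolding e_def permutations_def by auto
qed

lemma hereditary_pattern:
  assumes "hereditary P" "(n, \<pi>) \<in> P" "X \<subseteq> {1..n}" "(card X, \<sigma>) \<in> permutations"
    and \<sigma>: "\<And>x. x \<in> X \<Longrightarrow> \<sigma> (rank_in (\<lambda>x. x) X x) = rank_in \<pi> X x"
  shows "(card X, \<sigma>) \<in> P"
proof -
  have fin: "finite X" using assms(3) finite_subset by blast
  define e where "e = rank_in (\<lambda>x. x) X"
  have e: "bij_betw e X {1..card X}" unfolding e_def using fin by (intro bij_betw_rank_in) auto
  define i where "i = the_inv_into X e"
  have i: "i j \<in> X" "e (i j) = j" if "j \<in> {1..card X}" for j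
    using that e bij_betwE[OF bij_betw_the_inv_into[OF e]]
    by (auto simp: i_def f_the_inv_into_f_bij_betw)
  have "strict_mono_on {1..card X} i"
  proof (rule strict_mono_onI)
    fix r s assume rs: "r \<in> {1..card X}" "s \<in> {1..card X}" "r < s"
    show "i r < i s"
      using rank_in_less_iff[OF fin i(1)[OF rs(1)] i(1)[OF rs(2)], of "\<lambda>x. x"] rs i(2)[of r] i(2)[of s]
      by (auto simp: e_def)
  qed
  moreover have "i ` {1..card X} \<subseteq> {1..n}" using i assms(3) by auto
  moreover have "\<pi> (i j) < \<pi> (i l) \<longleftrightarrow> \<sigma> j < \<sigma> l" if "j \<in> {1..card X}" "l \<in> {1..card X}" for j l
    using rank_in_less_iff[OF fin i(1)[OF that(1)] i(1)[OF that(2)], of \<pi>]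
      \<sigma>[OF i(1)[OF that(1)]] \<sigma>[OF i(1)[OF that(2)]] i(2)[OF that(1)] i(2)[OF that(2)]
    by (auto simp: e_def)
  ultimately have "subpermutation (card X) \<sigma> n \<pi>" unfolding subpermutation_def by blast
  then show ?thesis using assms(1,2,4) unfolding hereditary_def by blast
qed

section \<open>Sorting by planar transpositions\<close>

definition inversion_set :: "nat \<Rightarrow> perm \<Rightarrow> (nat \<times> nat) set" where
  "inversion_set n C = {(u, v). u \<in> {1..n} \<and> v \<in> {1..n} \<and> u < v \<and> C u > C v}"

lemma finite_inversion_set [simp]: "finite (inversion_set n C)"
  by (rule finite_subset[of _ "{1..n} \<times> {1..n}"]) (auto simp: inversion_set_def)

lemma card_inversion_set_le: "card (inversion_set n C) \<le> n choose 2"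
proof -
  have "card (inversion_set n C) = card ((\<lambda>(u, v). {u, v}) ` inversion_set n C)"
    by (rule card_image[symmetric]) (auto simp: inversion_set_def inj_on_def doubleton_eq_iff)
  also have "\<dots> \<le> card {K. K \<subseteq> {1..n} \<and> card K = 2}"
    by (intro card_mono) (auto simp: inversion_set_def)
  also have "\<dots> = n choose 2" by (subst n_subsets) auto
  finally show ?thesis .
qed

lemma permutes_descent_exists:
  fixes C :: "nat \<Rightarrow> nat"
  assumes "C permutes {1..n}" "C \<noteq> id"
  obtains i where "1 \<le> i" "i + 1 \<le> n" "C i > C (i + 1)"
proof (rule ccontr)
  note descent = that
  assume "\<not> thesis"
  have asc: "C i \<le> C (i + 1)" if "1 \<le> i" "i + 1 \<le> n" for i
  proof (rule ccontr)
    assume "\<not> C i \<le> C (i + 1)"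
    then have "C (i + 1) < C i" by (simp only: not_le)
    then have "thesis" by (rule descent[OF that])
    with \<open>\<not> thesis\<close> show False ..
  qed
  have "i \<in> {1..n} \<longrightarrow> i \<le> C i" for i
  proof (induction i)
    case (Suc i)
    show ?case
    proof
      assume S: "Suc i \<in> {1..n}"
      show "Suc i \<le> C (Suc i)"
      proof (cases "i = 0")
        case True
        then show ?thesis using permutes_in_image[OF assms(1), of 1] S by auto
      next
        case False
        have "C i \<noteq> C (i + 1)" using inj_onD[OF permutes_inj_on[OF assms(1)], of i "i + 1" UNIV] by auto
        then show ?thesis using asc[of i] Suc S False by auto
      qed
    qed
  qed auto
  then have "C = id" using permutes_natset_ge[OF assms(1)] by blast
  with assms show False by blast
qed

lemma card_inversion_set_descent:
  assumes "1 \<le> i" "i + 1 \<le> n" "C i > C (i + 1)"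
  shows "card (inversion_set n (C \<circ> Transposition.transpose i (i + 1))) < card (inversion_set n C)"
proof -
  define s where "s = Transposition.transpose i (i + 1)"
  have inj: "inj_on (map_prod s s) A" for A
    unfolding s_def using prod.inj_map[OF inj_transpose inj_transpose] by (rule inj_on_subset) simp
  have s: "s u = (if u = i then i + 1 else if u = i + 1 then i else u)" for u
    by (simp add: s_def Transposition.transpose_def)
  have "map_prod s s ` inversion_set n (C \<circ> s) \<subseteq> inversion_set n C - {(i, i + 1)}"
  proof (rule image_subsetI)
    fix p assume "p \<in> inversion_set n (C \<circ> s)"
    then obtain u v where p: "p = (u, v)" "u \<in> {1..n}" "v \<in> {1..n}" "u < v" "C (s u) > C (s v)"
      by (auto simp: inversion_set_def)
    then have "(u, v) \<noteq> (i, i + 1)" using assms(3) by (auto simp: s)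
    then have "s u < s v" "(s u, s v) \<noteq> (i, i + 1)" "s u \<in> {1..n}" "s v \<in> {1..n}"
      using p assms(1,2) by (auto simp: s)
    then show "map_prod s s p \<in> inversion_set n C - {(i, i + 1)}"
      using p by (simp add: inversion_set_def)
  qed
  then have "card (inversion_set n (C \<circ> s)) \<le> card (inversion_set n C - {(i, i + 1)})"
    by (intro card_inj_on_le[OF inj]) auto
  also have "\<dots> < card (inversion_set n C)"
    using assms by (intro card_Diff1_less finite_inversion_set) (simp add: inversion_set_def)
  finally show ?thesis unfolding s_def .
qed

lemma planar_transposition_left:
  assumes "\<sigma> permutes {1..n}" "1 \<le> i" "i + 1 \<le> n"
  shows "planar_transposition n \<sigma> (Transposition.transpose i (i + 1) \<circ> \<sigma>)"
proof -
  have t: "Transposition.transpose i (i + 1) permutes {1..n}" using assms by (intro permutes_swap_id) auto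
  have "inv (Transposition.transpose i (i + 1) \<circ> \<sigma>) = inv \<sigma> \<circ> Transposition.transpose i (i + 1)"
    using o_inv_distrib[OF permutes_bij[OF t] permutes_bij[OF assms(1)]] by simp
  also have "\<dots> = (inv \<sigma>)(i := inv \<sigma> (i + 1), i + 1 := inv \<sigma> i)"
    by (auto simp: fun_eq_iff Transposition.transpose_def)
  finally show ?thesis unfolding planar_transposition_def
    using assms permutes_compose[OF assms(1) t] by blast
qed

lemma planar_transposition_right:
  assumes "\<sigma> permutes {1..n}" "1 \<le> i" "i + 1 \<le> n"
  shows "planar_transposition n \<sigma> (\<sigma> \<circ> Transposition.transpose i (i + 1))"
proof -
  have t: "Transposition.transpose i (i + 1) permutes {1..n}" using assms by (intro permutes_swap_id) auto
  have "\<sigma> \<circ> Transposition.transpose i (i + 1) = \<sigma>(i := \<sigma> (i + 1), i + 1 := \<sigma> i)"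
    by (auto simp: fun_eq_iff Transposition.transpose_def)
  then show ?thesis unfolding planar_transposition_def
    using assms permutes_compose[OF t assms(1)] by blast
qed

lemma planar_transpositions_sort:
  assumes "C permutes {1..n}"
  shows "\<exists>t \<le> card (inversion_set n C). \<forall>\<sigma>. \<sigma> permutes {1..n} \<longrightarrow>
    (planar_transposition n ^^ t) \<sigma> (C \<circ> \<sigma>) \<and> (planar_transposition n ^^ t) \<sigma> (\<sigma> \<circ> inv C)"
  using assms
proof (induction "card (inversion_set n C)" arbitrary: C rule: less_induct)
  case less
  show ?case
  proof (cases "C = id")
    case True
    then show ?thesis by (intro exI[of _ 0]) simp
  next
    case False
    obtain i where i: "1 \<le> i" "i + 1 \<le> n" "C i > C (i + 1)"
      using permutes_descent_exists[OF less.prems False] .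
    define s where "s = Transposition.transpose i (i + 1)"
    have s: "s permutes {1..n}" unfolding s_def using i by (intro permutes_swap_id) auto
    define C' where "C' = C \<circ> s"
    have C': "C' permutes {1..n}" unfolding C'_def by (rule permutes_compose[OF s less.prems])
    have lt: "card (inversion_set n C') < card (inversion_set n C)"
      unfolding C'_def s_def by (rule card_inversion_set_descent[OF i])
    from less.hyps[OF lt C'] obtain t where t: "t \<le> card (inversion_set n C')"
      and T: "\<And>\<sigma>. \<sigma> permutes {1..n} \<Longrightarrow> (planar_transposition n ^^ t) \<sigma> (C' \<circ> \<sigma>)"
         "\<And>\<sigma>. \<sigma> permutes {1..n} \<Longrightarrow> (planar_transposition n ^^ t) \<sigma> (\<sigma> \<circ> inv C')" by blast
    have invC': "inv C' = s \<circ> inv C"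
      unfolding C'_def using o_inv_distrib[OF permutes_bij[OF less.prems] permutes_bij[OF s]]
      by (simp add: s_def)
    have "(planar_transposition n ^^ Suc t) \<sigma> (C \<circ> \<sigma>)" if "\<sigma> permutes {1..n}" for \<sigma>
    proof -
      have e: "C' \<circ> (s \<circ> \<sigma>) = C \<circ> \<sigma>" by (simp add: C'_def s_def fun_eq_iff)
      have "planar_transposition n \<sigma> (s \<circ> \<sigma>)"
        unfolding s_def by (rule planar_transposition_left[OF that i(1,2)])
      then show ?thesis
        using T(1)[OF permutes_compose[OF that s]] unfolding e by (rule relpowp_Suc_I2[where P = "planar_transposition n"])
    qed
    moreover have "(planar_transposition n ^^ Suc t) \<sigma> (\<sigma> \<circ> inv C)" if "\<sigma> permutes {1..n}" for \<sigma>
    proof -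
      have e: "\<sigma> \<circ> s \<circ> inv C' = \<sigma> \<circ> inv C" by (simp add: invC' s_def fun_eq_iff)
      have "planar_transposition n \<sigma> (\<sigma> \<circ> s)"
        unfolding s_def by (rule planar_transposition_right[OF that i(1,2)])
      then show ?thesis
        using T(2)[OF permutes_compose[OF s that]] unfolding e by (rule relpowp_Suc_I2[where P = "planar_transposition n"])
    qed
    ultimately show ?thesis using t lt by (intro exI[of _ "Suc t"]) auto
  qed
qed

lemma rho_PT_le:
  assumes "\<pi> permutes {1..n}" "A permutes {1..n}" "C permutes {1..n}" "n \<ge> 2"
  shows "rho_PT n \<pi> (C \<circ> \<pi> \<circ> inv A)
    \<le> real (card (inversion_set n A) + card (inversion_set n C)) / real (n choose 2)"
proof -
  obtain s where s: "s \<le> card (inversion_set n A)" "(planar_transposition n ^^ s) \<pi> (\<pi> \<circ> inv A)"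
    using planar_transpositions_sort[OF assms(2)] assms(1) by blast
  obtain t where t: "t \<le> card (inversion_set n C)"
    "(planar_transposition n ^^ t) (\<pi> \<circ> inv A) (C \<circ> (\<pi> \<circ> inv A))"
    using planar_transpositions_sort[OF assms(3)]
      permutes_compose[OF permutes_inv[OF assms(2)] assms(1)] by blast
  have "(planar_transposition n ^^ (s + t)) \<pi> (C \<circ> \<pi> \<circ> inv A)"
    using s t by (auto simp: relpowp_add comp_assoc)
  then have "(LEAST t. (planar_transposition n ^^ t) \<pi> (C \<circ> \<pi> \<circ> inv A)) \<le> s + t" by (rule Least_le)
  then show ?thesis using s t assms(4) unfolding rho_PT_def by (auto intro!: divide_right_mono)
qed

lemma finite_permutations_length: "finite {\<pi>. (n, \<pi>) \<in> permutations}"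
  by (rule finite_subset[OF _ finite_permutations[of "{1..n}"]]) (auto simp: permutations_def)

lemma dist_PT_le_rho_PT:
  assumes "permutation_property P" "(n, \<pi>\<^sub>0) \<in> P"
  shows "dist_PT P n \<pi> \<le> rho_PT n \<pi> \<pi>\<^sub>0"
proof -
  have "finite {\<pi>\<^sub>0. (n, \<pi>\<^sub>0) \<in> P}"
    using assms(1) finite_permutations_length[of n] unfolding permutation_property_def
    by (elim finite_subset[rotated]) auto
  then have "finite ((\<lambda>\<pi>\<^sub>0. rho_PT n \<pi> \<pi>\<^sub>0) ` {\<pi>\<^sub>0. (n, \<pi>\<^sub>0) \<in> P})" by blast
  then have "Min {rho_PT n \<pi> \<pi>\<^sub>0 |\<pi>\<^sub>0. (n, \<pi>\<^sub>0) \<in> P} \<le> rho_PT n \<pi> \<pi>\<^sub>0"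
    using assms(2) by (intro Min_le) (auto simp: image_Collect)
  then show ?thesis using assms(2) unfolding dist_PT_def by auto
qed

lemma dist_PT_le_1:
  assumes "permutation_property P" "(n, \<pi>) \<in> permutations"
  shows "dist_PT P n \<pi> \<le> 1"
proof (cases "\<exists>\<pi>\<^sub>0. (n, \<pi>\<^sub>0) \<in> P")
  case True
  then obtain \<pi>\<^sub>0 where p: "(n, \<pi>\<^sub>0) \<in> P" by blast
  have perm: "\<pi>\<^sub>0 permutes {1..n}" "\<pi> permutes {1..n}" "n \<ge> 1"
    using assms p by (auto simp: permutation_property_def permutations_def)
  have "rho_PT n \<pi> \<pi>\<^sub>0 \<le> 1"
  proof (cases "n = 1")
    case False
    then have n: "n \<ge> 2" using perm by auto
    define C where "C = \<pi>\<^sub>0 \<circ> inv \<pi>"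
    have C: "C permutes {1..n}" unfolding C_def by (rule permutes_compose[OF permutes_inv[OF perm(2)] perm(1)])
    have e: "C \<circ> \<pi> \<circ> inv id = \<pi>\<^sub>0" by (simp add: C_def comp_assoc permutes_inv_o[OF perm(2)])
    have "inversion_set n id = {}" by (auto simp: inversion_set_def)
    then have "rho_PT n \<pi> \<pi>\<^sub>0 \<le> real (card (inversion_set n C)) / real (n choose 2)"
      using rho_PT_le[OF perm(2) permutes_id C n] unfolding e by simp
    also have "\<dots> \<le> 1"
      using card_inversion_set_le[of n C] n by (auto simp: divide_le_eq_1)
    finally show ?thesis .
  qed (auto simp: rho_PT_def)
  then show ?thesis using dist_PT_le_rho_PT[OF assms(1) p, of \<pi>] by linarith
qed (auto simp: dist_PT_def)

section \<open>Distance of a permutation to a blow-up of an accepted sample\<close>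

lemma card_weak_inversions_le:
  fixes F :: "nat \<Rightarrow> nat"
  assumes "I \<subseteq> {(u, v). u \<in> {1..n} \<and> v \<in> {1..n} \<and> u < v \<and> F v \<le> F u}"
  shows "card I \<le> (\<Sum>u\<in>{1..n}. 2 * nat \<bar>int (F u) - int u\<bar>)"
proof -
  let ?R = "\<Union>u\<in>{1..n}. Pair u ` {u<..u + 2 * (F u - u)}"
  let ?L = "\<Union>v\<in>{1..n}. (\<lambda>u. (u, v)) ` {v - 2 * (v - F v)..<v}"
  have "I \<subseteq> ?R \<union> ?L"
  proof
    fix p assume "p \<in> I"
    then obtain u v where p: "p = (u, v)" "u \<in> {1..n}" "v \<in> {1..n}" "u < v" "F v \<le> F u"
      using assms by auto
    then have "v \<le> u + 2 * (F u - u) \<or> v - 2 * (v - F v) \<le> u" by linarith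
    then show "p \<in> ?R \<union> ?L"
    proof
      assume "v \<le> u + 2 * (F u - u)"
      then have "p \<in> Pair u ` {u<..u + 2 * (F u - u)}" using p by auto
      then show ?thesis using p by blast
    next
      assume "v - 2 * (v - F v) \<le> u"
      then have "p \<in> (\<lambda>u. (u, v)) ` {v - 2 * (v - F v)..<v}" using p by auto
      then show ?thesis using p by blast
    qed
  qed
  then have "card I \<le> card ?R + card ?L"
    by (intro order_trans[OF card_mono card_Un_le]) auto
  also have "card ?R \<le> (\<Sum>u\<in>{1..n}. 2 * (F u - u))"
    by (intro order_trans[OF card_UN_le sum_mono] order_trans[OF card_image_le]) auto
  also have "card ?L \<le> (\<Sum>v\<in>{1..n}. 2 * (v - F v))"
    by (intro order_trans[OF card_UN_le sum_mono] order_trans[OF card_image_le]) auto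
  also have "(\<Sum>u\<in>{1..n}. 2 * (F u - u)) + (\<Sum>v\<in>{1..n}. 2 * (v - F v))
      = (\<Sum>u\<in>{1..n}. 2 * nat \<bar>int (F u) - int u\<bar>)"
    unfolding sum.distrib[symmetric] by (intro sum.cong) auto
  finally show ?thesis by simp
qed

definition accepts :: "(nat \<times> perm) set \<Rightarrow> nat \<Rightarrow> nat set \<Rightarrow> (nat \<Rightarrow> nat) \<Rightarrow> bool" where
  "accepts P M S h \<longleftrightarrow> (\<exists>\<beta> e. (M, \<beta>) \<in> permutations \<and> k_star_perm P M \<beta> = \<infinity> \<and>
     e ` S \<subseteq> {1..M} \<and> strict_mono_on S e \<and>
     (\<forall>x\<in>S. \<forall>y\<in>S. h x < h y \<longleftrightarrow> \<beta> (e x) < \<beta> (e y)))"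

lemma k_blow_up_bounds:
  assumes "blow_up_with K m \<alpha> m' \<alpha>'" "\<forall>j\<in>{1..m}. K (j + 1) - K j = k" "j \<le> m"
  shows "K (j + 1) = 1 + j * k"
  using assms(3)
proof (induction j)
  case 0
  then show ?case using assms(1) by (simp add: blow_up_with_def)
next
  case (Suc j)
  have "K (Suc j) < K (Suc j + 1)"
    using assms(1) Suc.prems unfolding blow_up_with_def by (auto dest!: strict_mono_onD[of _ K "Suc j" "Suc j + 1"])
  moreover have "K (Suc j + 1) - K (Suc j) = k" using assms(2) Suc.prems by auto
  ultimately show ?case using Suc by simp
qed

lemma k_blow_up_in_if_k_star_perm_infinite:
  assumes "k_star_perm P m \<alpha> = \<infinity>" "k \<ge> 1"
  obtains K \<gamma> where "(m * k, \<gamma>) \<in> permutations" "(m * k, \<gamma>) \<in> P"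
    "blow_up_with K m \<alpha> (m * k) \<gamma>" "\<And>j. j \<le> m \<Longrightarrow> K (j + 1) = 1 + j * k"
proof -
  have "\<not> no_k_blow_up_in P k m \<alpha>"
    using assms unfolding k_star_perm_def by (auto split: if_splits)
  then obtain m' \<gamma> K where g: "(m', \<gamma>) \<in> permutations" "(m', \<gamma>) \<in> P"
    "blow_up_with K m \<alpha> m' \<gamma>" "\<forall>j\<in>{1..m}. K (j + 1) - K j = k"
    unfolding no_k_blow_up_in_def k_blow_up_def by blast
  note K = k_blow_up_bounds[OF g(3,4)]
  have "m' = m * k" using K[of m] g(3) by (simp add: blow_up_with_def)
  with g K show ?thesis using that by blast
qed

lemma dist_PT_le_assignment:
  assumes P: "permutation_property P" "hereditary P" and perm: "(n, \<pi>) \<in> permutations"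
    and n: "n \<ge> 2" and acc: "accepts P M S \<pi>" and f: "f ` {1..n} \<subseteq> S"
  shows "dist_PT P n \<pi> \<le> real (\<Sum>p\<in>{1..n}. 2 * nat \<bar>int (f p) - int p\<bar>
    + 2 * nat \<bar>int (\<pi> (f p)) - int (\<pi> p)\<bar>) / real (n choose 2)"
proof -
  from acc obtain \<beta> e where \<beta>: "(M, \<beta>) \<in> permutations" "k_star_perm P M \<beta> = \<infinity>"
    and e: "e ` S \<subseteq> {1..M}" "strict_mono_on S e"
    and \<beta>e: "\<And>x y. x \<in> S \<Longrightarrow> y \<in> S \<Longrightarrow> \<pi> x < \<pi> y \<longleftrightarrow> \<beta> (e x) < \<beta> (e y)"
    unfolding accepts_def by blast
  have pi: "\<pi> permutes {1..n}" using perm by (simp add: permutations_def)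
  obtain K \<gamma> where \<gamma>: "(M * n, \<gamma>) \<in> permutations" "(M * n, \<gamma>) \<in> P"
      "blow_up_with K M \<beta> (M * n) \<gamma>" and K: "\<And>j. j \<le> M \<Longrightarrow> K (j + 1) = 1 + j * n"
    using k_blow_up_in_if_k_star_perm_infinite[OF \<beta>(2), of n] n
    by (metis One_nat_def Suc_1 Suc_leD)
  define b where "b p = e (f p)" for p
  have b: "b p \<in> {1..M}" if "p \<in> {1..n}" for p using that e(1) f by (auto simp: b_def image_subset_iff)
  define \<tau> where "\<tau> p = (b p - 1) * n + p" for p
  have block: "\<tau> p \<in> {K (b p)..<K (b p + 1)}" if p: "p \<in> {1..n}" for p
  proof -
    obtain c where c: "b p = Suc c" "Suc c \<le> M" using b[OF p] by (cases "b p") auto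
    then show ?thesis using p K[of c] K[of "Suc c"] by (auto simp: \<tau>_def)
  qed
  have \<tau>_less: "\<tau> p < \<tau> q" if "p \<in> {1..n}" "q \<in> {1..n}" "b p < b q" for p q
  proof -
    have "b p * n \<le> (b q - 1) * n" using that(3) by (intro mult_right_mono) auto
    moreover have "\<tau> p \<le> b p * n" using b[OF that(1)] that(1) by (cases "b p") (auto simp: \<tau>_def)
    moreover have "(b q - 1) * n < \<tau> q" using that(2) by (auto simp: \<tau>_def)
    ultimately show ?thesis by linarith
  qed
  have inj: "inj_on \<tau> {1..n}"
  proof (rule inj_onI)
    fix p q assume pq: "p \<in> {1..n}" "q \<in> {1..n}" "\<tau> p = \<tau> q"
    then have "b p = b q" using \<tau>_less[of p q] \<tau>_less[of q p] by (cases "b p" "b q" rule: linorder_cases) auto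
    then show "p = q" using pq(3) by (simp add: \<tau>_def)
  qed
  define T where "T = \<tau> ` {1..n}"
  have T: "finite T" "card T = n" "T \<noteq> {}" using inj n by (auto simp: T_def card_image)
  have TM: "T \<subseteq> {1..M * n}"
  proof
    fix t assume "t \<in> T"
    then obtain p where p: "p \<in> {1..n}" "t = \<tau> p" by (auto simp: T_def)
    have "\<tau> p \<le> b p * n" using b[OF p(1)] p(1) by (cases "b p") (auto simp: \<tau>_def)
    also have "\<dots> \<le> M * n" using b[OF p(1)] by auto
    finally show "t \<in> {1..M * n}" using p by (auto simp: \<tau>_def)
  qed
  have \<gamma>p: "\<gamma> permutes {1..M * n}" using \<gamma> by (simp add: permutations_def)
  have inj\<gamma>: "inj_on \<gamma> T" using permutes_inj[OF \<gamma>p] by (rule inj_on_subset) simp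
  obtain \<sigma> where \<sigma>: "(n, \<sigma>) \<in> permutations"
    and rk: "\<And>t. t \<in> T \<Longrightarrow> \<sigma> (rank_in (\<lambda>x. x) T t) = rank_in \<gamma> T t"
    using pattern_exists[OF T(1,3) inj\<gamma>] T(2) by metis
  have \<sigma>P: "(n, \<sigma>) \<in> P"
    using hereditary_pattern[OF P(2) \<gamma>(2) TM, of \<sigma>] \<sigma> rk T(2) by simp
  have \<sigma>p: "\<sigma> permutes {1..n}" using \<sigma> by (simp add: permutations_def)
  have \<tau>T: "\<tau> p \<in> T" if "p \<in> {1..n}" for p using that by (auto simp: T_def)

  define A where "A p = (if p \<in> {1..n} then rank_in (\<lambda>x. x) T (\<tau> p) else p)" for p
  have bT: "bij_betw \<tau> {1..n} T" using inj by (auto simp: T_def bij_betw_def)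
  have "bij_betw A {1..n} {1..n}"
    using bij_betw_trans[OF bT bij_betw_rank_in[OF T(1), of "\<lambda>x. x"]] T(2)
    by (subst bij_betw_cong[of _ A "rank_in (\<lambda>x. x) T \<circ> \<tau>"]) (auto simp: A_def)
  then have A: "A permutes {1..n}" by (rule bij_imp_permutes) (auto simp: A_def)

  define B where "B p = (if p \<in> {1..n} then rank_in \<gamma> T (\<tau> p) else p)" for p
  have "bij_betw B {1..n} {1..n}"
    using bij_betw_trans[OF bT bij_betw_rank_in[OF T(1) inj\<gamma>]] T(2)
    by (subst bij_betw_cong[of _ B "rank_in \<gamma> T \<circ> \<tau>"]) (auto simp: B_def)
  then have B: "B permutes {1..n}" by (rule bij_imp_permutes) (auto simp: B_def)
  define C where "C = B \<circ> inv \<pi>"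
  have C: "C permutes {1..n}" unfolding C_def by (rule permutes_compose[OF permutes_inv[OF pi] B])
  have "\<sigma> (A p) = B p" for p
    using rk[OF \<tau>T, of p] permutes_not_in[OF \<sigma>p, of p] by (auto simp: A_def B_def)
  then have "\<sigma> \<circ> A = B" by auto
  moreover have "C \<circ> \<pi> = B" by (simp add: C_def comp_assoc permutes_inv_o[OF pi])
  ultimately have "C \<circ> \<pi> \<circ> inv A = \<sigma> \<circ> (A \<circ> inv A)"
    by (simp only: comp_assoc[symmetric])
  then have \<sigma>_eq: "C \<circ> \<pi> \<circ> inv A = \<sigma>" by (simp add: permutes_inv_o[OF A])

  have "inversion_set n A \<subseteq> {(u, v). u \<in> {1..n} \<and> v \<in> {1..n} \<and> u < v \<and> f v \<le> f u}"
  proof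
    fix x assume "x \<in> inversion_set n A"
    then obtain p q where x: "x = (p, q)" and pq: "p \<in> {1..n}" "q \<in> {1..n}" "p < q" "A q < A p"
      by (auto simp: inversion_set_def)
    then have "\<tau> q < \<tau> p"
      using rank_in_less_iff[OF T(1) \<tau>T[OF pq(2)] \<tau>T[OF pq(1)], of "\<lambda>x. x"] by (simp add: A_def)
    then have "\<not> b p < b q" using \<tau>_less[OF pq(1,2)] by auto
    then have "\<not> f p < f q"
      using strict_mono_onD[OF e(2), of "f p" "f q"] f pq by (auto simp: b_def image_subset_iff)
    then show "x \<in> {(u, v). u \<in> {1..n} \<and> v \<in> {1..n} \<and> u < v \<and> f v \<le> f u}" using x pq by auto
  qed
  note invA = card_weak_inversions_le[OF this]

  define F where "F u = \<pi> (f (inv \<pi> u))" for u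
  have "inversion_set n C \<subseteq> {(u, v). u \<in> {1..n} \<and> v \<in> {1..n} \<and> u < v \<and> F v \<le> F u}"
  proof
    fix x assume "x \<in> inversion_set n C"
    then obtain u v where x: "x = (u, v)" and uv: "u \<in> {1..n}" "v \<in> {1..n}" "u < v" "C v < C u"
      by (auto simp: inversion_set_def)
    define p q where "p = inv \<pi> u" and "q = inv \<pi> v"
    have pq: "p \<in> {1..n}" "q \<in> {1..n}"
      unfolding p_def q_def using permutes_in_image[OF permutes_inv[OF pi]] uv by blast+
    have fS: "f p \<in> S" "f q \<in> S" using f pq by blast+
    have "B q < B p" using uv by (simp add: C_def p_def q_def)
    then have \<gamma>l: "\<gamma> (\<tau> q) < \<gamma> (\<tau> p)"
      using rank_in_less_iff[OF T(1) \<tau>T[OF pq(2)] \<tau>T[OF pq(1)], of \<gamma>] pq by (simp add: B_def)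
    have "\<pi> (f q) \<le> \<pi> (f p)"
    proof (cases "b p = b q")
      case True
      then have "f p = f q" using strict_mono_on_imp_inj_on[OF e(2)] fS by (auto simp: b_def dest: inj_onD)
      then show ?thesis by simp
    next
      case False
      then have "\<beta> (b q) < \<beta> (b p)"
        using \<gamma>(3) \<gamma>l b[OF pq(1)] b[OF pq(2)] block[OF pq(1)] block[OF pq(2)]
        unfolding blow_up_with_def by blast
      then show ?thesis using \<beta>e[OF fS(2,1)] by (simp add: b_def)
    qed
    then show "x \<in> {(u, v). u \<in> {1..n} \<and> v \<in> {1..n} \<and> u < v \<and> F v \<le> F u}"
      using x uv by (auto simp: F_def p_def q_def)
  qed
  note invC = card_weak_inversions_le[OF this]
  have "(\<Sum>u\<in>{1..n}. 2 * nat \<bar>int (F u) - int u\<bar>)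
      = (\<Sum>p\<in>{1..n}. 2 * nat \<bar>int (\<pi> (f p)) - int (\<pi> p)\<bar>)"
    by (subst sum.permute[OF pi]) (simp add: F_def permutes_inverses[OF pi])
  then have "card (inversion_set n A) + card (inversion_set n C)
     \<le> (\<Sum>p\<in>{1..n}. 2 * nat \<bar>int (f p) - int p\<bar> + 2 * nat \<bar>int (\<pi> (f p)) - int (\<pi> p)\<bar>)"
    using invA invC by (simp add: sum.distrib)
  then have "rho_PT n \<pi> \<sigma> \<le> real (\<Sum>p\<in>{1..n}. 2 * nat \<bar>int (f p) - int p\<bar>
      + 2 * nat \<bar>int (\<pi> (f p)) - int (\<pi> p)\<bar>) / real (n choose 2)"
    using rho_PT_le[OF pi A C n] unfolding \<sigma>_eq
    by (elim order_trans) (intro divide_right_mono of_nat_mono, auto)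
  then show ?thesis using dist_PT_le_rho_PT[OF P(1) \<sigma>P, of \<pi>] by linarith
qed

section \<open>Distance to a random sample\<close>

lemma power_one_minus_le:
  fixes t :: real
  assumes "0 < t" "t \<le> 1" "m \<ge> 1"
  shows "(1 - t) ^ m \<le> 1 / (real m * t)"
proof -
  have "real m * t \<le> (1 + t) ^ m" using Bernoulli_inequality[of t m] assms by auto
  then have "(1 - t) ^ m * (real m * t) \<le> (1 - t) ^ m * (1 + t) ^ m"
    using assms by (intro mult_left_mono) auto
  also have "\<dots> = (1 - t\<^sup>2) ^ m"
    by (simp add: power_mult_distrib[symmetric] power2_eq_square algebra_simps)
  also have "\<dots> \<le> 1" using assms by (intro power_le_one) (auto simp: power_le_one)
  finally show ?thesis using assms by (simp add: field_simps)
qed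

lemma sum_inverse_card_class:
  assumes "finite X"
  shows "(\<Sum>p\<in>X. 1 / real (card {q \<in> X. g q = g p})) = real (card (g ` X))"
proof -
  have "(\<Sum>p\<in>X. 1 / real (card {q \<in> X. g q = g p}))
      = (\<Sum>y\<in>g ` X. \<Sum>p\<in>{p \<in> X. g p = y}. 1 / real (card {q \<in> X. g q = g p}))"
    by (rule sum.image_gen[OF assms])
  also have "\<dots> = (\<Sum>y\<in>g ` X. 1)"
  proof (rule sum.cong[OF refl])
    fix y assume "y \<in> g ` X"
    then have "{p \<in> X. g p = y} \<noteq> {}" by auto
    then have "card {p \<in> X. g p = y} > 0" using assms by (simp add: card_gt_0_iff)
    moreover have "(\<Sum>p\<in>{p \<in> X. g p = y}. 1 / real (card {q \<in> X. g q = g p}))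
        = (\<Sum>p\<in>{p \<in> X. g p = y}. 1 / real (card {q \<in> X. g q = y}))"
      by (intro sum.cong) auto
    ultimately show "(\<Sum>p\<in>{p \<in> X. g p = y}. 1 / real (card {q \<in> X. g q = g p})) = 1" by simp
  qed
  finally show ?thesis by simp
qed

lemma sum_card_missed_le:
  fixes g :: "nat \<Rightarrow> 'a"
  assumes "n \<ge> 1" "m \<ge> 1" and L: "L = {xs. set xs \<subseteq> {1..n} \<and> length xs = m}"
  shows "(\<Sum>xs\<in>L. real (card {p \<in> {1..n}. \<forall>x\<in>set xs. g x \<noteq> g p}))
    \<le> real n ^ m * (real n * real (card (g ` {1..n})) / real m)"
proof -
  have fin: "finite L" unfolding L by (rule finite_lists_length_eq) simp
  define c where "c p = card {q \<in> {1..n}. g q = g p}" for p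
  have "(\<Sum>xs\<in>L. real (card {p \<in> {1..n}. \<forall>x\<in>set xs. g x \<noteq> g p}))
      = (\<Sum>xs\<in>L. \<Sum>p\<in>{1..n}. if \<forall>x\<in>set xs. g x \<noteq> g p then 1 else 0)"
    by (simp add: sum.If_cases Int_def)
  also have "\<dots> = (\<Sum>p\<in>{1..n}. \<Sum>xs\<in>L. if \<forall>x\<in>set xs. g x \<noteq> g p then 1 else 0)"
    by (rule sum.swap)
  also have "\<dots> = (\<Sum>p\<in>{1..n}. real (card {xs \<in> L. \<forall>x\<in>set xs. g x \<noteq> g p}))"
    using fin by (simp add: sum.If_cases Int_def)
  also have "\<dots> \<le> (\<Sum>p\<in>{1..n}. real n ^ m * (real n / real m * (1 / real (c p))))"
  proof (rule sum_mono)
    fix p assume p: "p \<in> {1..n}"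
    have "{q \<in> {1..n}. g q = g p} \<noteq> {}" using p by auto
    then have c: "c p > 0" by (simp add: c_def card_gt_0_iff)
    have cn: "c p \<le> n" unfolding c_def by (rule order_trans[OF card_mono[of "{1..n}"]]) auto
    have eq: "{xs \<in> L. \<forall>x\<in>set xs. g x \<noteq> g p}
        = {xs. set xs \<subseteq> {1..n} - {q \<in> {1..n}. g q = g p} \<and> length xs = m}"
      by (auto simp: L)
    have count: "card {xs \<in> L. \<forall>x\<in>set xs. g x \<noteq> g p} = (n - c p) ^ m"
    proof -
      have "card ({1..n} - {q \<in> {1..n}. g q = g p}) = n - c p"
        unfolding c_def by (subst card_Diff_subset) auto
      then show ?thesis unfolding eq by (subst card_lists_length_eq) simp_all
    qed
    have "real (card {xs \<in> L. \<forall>x\<in>set xs. g x \<noteq> g p}) = (real n * (1 - real (c p) / real n)) ^ m"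
    proof -
      have "real n * (1 - real (c p) / real n) = real (n - c p)"
        using cn assms(1) by (simp add: of_nat_diff right_diff_distrib)
      then show ?thesis using count by (simp only: of_nat_power)
    qed
    also have "\<dots> = real n ^ m * (1 - real (c p) / real n) ^ m" by (rule power_mult_distrib)
    also have "\<dots> \<le> real n ^ m * (1 / (real m * (real (c p) / real n)))"
      using c cn assms by (intro mult_left_mono power_one_minus_le) auto
    also have "1 / (real m * (real (c p) / real n)) = real n / real m * (1 / real (c p))" by simp
    finally show "real (card {xs \<in> L. \<forall>x\<in>set xs. g x \<noteq> g p})
      \<le> real n ^ m * (real n / real m * (1 / real (c p)))" .
  qed
  also have "\<dots> = real n ^ m * (real n / real m * (\<Sum>p\<in>{1..n}. 1 / real (c p)))"
    by (simp add: sum_distrib_left)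
  also have "(\<Sum>p\<in>{1..n}. 1 / real (c p)) = real (card (g ` {1..n}))"
    unfolding c_def by (rule sum_inverse_card_class) simp
  finally show ?thesis by (simp add: field_simps)
qed

lemma sum_min_inverse_square_le:
  fixes a c :: real
  assumes "0 \<le> a" "0 \<le> c" "k \<ge> 1"
  shows "(\<Sum>s\<in>{1..N}. min a (c / (real s)\<^sup>2)) \<le> a * real k + c / real k"
proof -
  have small: "(\<Sum>s\<in>{1..N}. min a (c / (real s)\<^sup>2)) \<le> a * real N" for N
    using sum_bounded_above[of "{1..N}" "\<lambda>s. min a (c / (real s)\<^sup>2)" a] by (simp add: mult.commute)
  show ?thesis
  proof (cases "N \<le> k")
    case True
    then have "a * real N \<le> a * real k" using assms by (intro mult_left_mono) auto
    moreover have "0 \<le> c / real k" using assms by simp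
    ultimately show ?thesis using small[of N] by linarith
  next
    case False
    then have "k \<le> N" by simp
    then have "(\<Sum>s\<in>{1..N}. min a (c / (real s)\<^sup>2)) \<le> a * real k + c * (1 / real k - 1 / real N)"
    proof (induction N rule: dec_induct)
      case base
      show ?case using small[of k] by simp
    next
      case (step N)
      have N: "real N > 0" using step assms by simp
      have "1 / (real (Suc N))\<^sup>2 \<le> 1 / (real N * real (Suc N))"
        using N by (intro divide_left_mono) (auto simp: power2_eq_square)
      also have "\<dots> = 1 / real N - 1 / real (Suc N)" using N by (simp add: field_simps)
      finally have "c * (1 / (real (Suc N))\<^sup>2) \<le> c * (1 / real N - 1 / real (Suc N))"
        using assms by (intro mult_left_mono)
      then have "min a (c / (real (Suc N))\<^sup>2) \<le> c * (1 / real N - 1 / real (Suc N))" by auto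
      then show ?case using step.IH by (simp add: algebra_simps)
    qed
    also have "\<dots> \<le> a * real k + c / real k" using assms by (simp add: algebra_simps)
    finally show ?thesis .
  qed
qed

lemma markov_card:
  fixes Z :: "'a \<Rightarrow> real"
  assumes "finite L" "\<And>x. x \<in> L \<Longrightarrow> 0 \<le> Z x"
  shows "t * real (card {x \<in> L. t < Z x}) \<le> sum Z L"
proof -
  have "t * real (card {x \<in> L. t < Z x}) = (\<Sum>x\<in>{x \<in> L. t < Z x}. t)" by simp
  also have "\<dots> \<le> sum Z {x \<in> L. t < Z x}" by (rule sum_mono) auto
  also have "\<dots> \<le> sum Z L" using assms by (intro sum_mono2) auto
  finally show ?thesis .
qed

lemma card_boxes_le:
  fixes \<pi> :: perm
  assumes "\<pi> permutes {1..n}"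
  shows "card ((\<lambda>x. ((x - 1) div s, (\<pi> x - 1) div s)) ` {1..n}) \<le> ((n - 1) div s + 1)\<^sup>2"
proof -
  let ?B = "{..(n - 1) div s}"
  have "(\<lambda>x. ((x - 1) div s, (\<pi> x - 1) div s)) ` {1..n} \<subseteq> ?B \<times> ?B"
  proof (rule image_subsetI)
    fix x assume "x \<in> {1..n}"
    moreover from this have "\<pi> x \<in> {1..n}" using permutes_in_image[OF assms(1)] by blast
    ultimately show "((x - 1) div s, (\<pi> x - 1) div s) \<in> ?B \<times> ?B"
      by (auto intro!: div_le_mono diff_le_mono)
  qed
  then have "card ((\<lambda>x. ((x - 1) div s, (\<pi> x - 1) div s)) ` {1..n}) \<le> card (?B \<times> ?B)"
    by (rule card_mono[rotated]) simp
  then show ?thesis by (simp add: power2_eq_square card_cartesian_product)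
qed

lemma close_if_div_eq:
  fixes x y s :: nat
  assumes "(x - 1) div s = (y - 1) div s" "s \<ge> 1" "x \<ge> 1" "y \<ge> 1"
  shows "nat \<bar>int x - int y\<bar> < s"
proof -
  define c where "c = s * ((x - 1) div s)"
  have "c + (x - 1) mod s = x - 1" "c + (y - 1) mod s = y - 1"
    unfolding c_def using mult_div_mod_eq[of s "x - 1"] mult_div_mod_eq[of s "y - 1"]
    by (simp_all only: assms(1))
  moreover have "(x - 1) mod s < s" "(y - 1) mod s < s" using assms by auto
  ultimately show ?thesis using assms by linarith
qed

lemma card_accepts_le_if_far:
  assumes P: "permutation_property P" "hereditary P" and perm: "(n, \<pi>) \<in> permutations"
    and \<epsilon>: "0 < \<epsilon>" "\<epsilon> < 1" and m: "real m \<ge> 10000 / \<epsilon>\<^sup>2" and n: "real n \<ge> 600 / \<epsilon> + 25"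
    and far: "far_PT \<epsilon> P n \<pi>" and L: "L = {xs. set xs \<subseteq> {1..n} \<and> length xs = m}"
  shows "3 * card {xs \<in> L. accepts P M (set xs) \<pi>} \<le> n ^ m"
proof -
  have pi: "\<pi> permutes {1..n}" using perm by (simp add: permutations_def)
  have "600 / \<epsilon> > 0" "10000 / \<epsilon>\<^sup>2 > 0" using \<epsilon> by auto
  then have n2: "n \<ge> 25" and m1: "m \<ge> 1" using n m by linarith+
  have fin: "finite L" unfolding L by (rule finite_lists_length_eq) simp
  define d where "d x p = max (nat \<bar>int x - int p\<bar>) (nat \<bar>int (\<pi> x) - int (\<pi> p)\<bar>)" for x p
  define f where "f xs p = arg_min_on (\<lambda>x. d x p) (set xs)" for xs p
  have f: "f xs p \<in> set xs" if "xs \<in> L" for xs p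
    unfolding f_def using that m1 by (intro arg_min_if_finite(1)) (auto simp: L)
  have fmin: "d (f xs p) p \<le> d x p" if "x \<in> set xs" for xs x p
    unfolding f_def using that by (intro arg_min_least) auto
  define Z where "Z xs = (\<Sum>p\<in>{1..n}. real (d (f xs p) p))" for xs
  define box where "box s x = ((x - 1) div s, (\<pi> x - 1) div s)" for s x
  have near: "d x p < s" if "box s x = box s p" "s \<ge> 1" "x \<in> {1..n}" "p \<in> {1..n}" for s x p
    using that close_if_div_eq[of x s p] close_if_div_eq[of "\<pi> x" s "\<pi> p"]
      permutes_in_image[OF pi, of x] permutes_in_image[OF pi, of p] by (auto simp: box_def d_def)

  have Z_le: "Z xs \<le> (\<Sum>s\<in>{1..n - 1}. real (card {p \<in> {1..n}. \<forall>x\<in>set xs. box s x \<noteq> box s p}))"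
    if "xs \<in> L" for xs
  proof -
    have xs: "set xs \<subseteq> {1..n}" using that by (auto simp: L)
    have D: "real (d (f xs p) p) = (\<Sum>s\<in>{1..n - 1}. if s \<le> d (f xs p) p then 1 else 0)" if p: "p \<in> {1..n}" for p
    proof -
      have "d (f xs p) p \<le> n - 1"
        using xs f[OF \<open>xs \<in> L\<close>, of p] p near[of n "f xs p" p] permutes_in_image[OF pi, of p]
          permutes_in_image[OF pi, of "f xs p"] by (auto simp: box_def)
      then have "{1..n - 1} \<inter> {s. s \<le> d (f xs p) p} = {1..d (f xs p) p}" by auto
      then show ?thesis by (simp add: sum.If_cases)
    qed
    have "Z xs = (\<Sum>p\<in>{1..n}. \<Sum>s\<in>{1..n - 1}. if s \<le> d (f xs p) p then 1 else 0)"
      unfolding Z_def by (intro sum.cong refl D)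
    also have "\<dots> = (\<Sum>s\<in>{1..n - 1}. \<Sum>p\<in>{1..n}. if s \<le> d (f xs p) p then 1 else 0)"
      by (rule sum.swap)
    also have "\<dots> = (\<Sum>s\<in>{1..n - 1}. real (card {p \<in> {1..n}. s \<le> d (f xs p) p}))"
      by (simp add: sum.If_cases Int_def)
    also have "\<dots> \<le> (\<Sum>s\<in>{1..n - 1}. real (card {p \<in> {1..n}. \<forall>x\<in>set xs. box s x \<noteq> box s p}))"
    proof (intro sum_mono of_nat_mono card_mono subsetI)
      fix s p assume s: "s \<in> {1..n - 1}" and p: "p \<in> {p \<in> {1..n}. s \<le> d (f xs p) p}"
      show "p \<in> {p \<in> {1..n}. \<forall>x\<in>set xs. box s x \<noteq> box s p}"
        using near[of s _ p] fmin[of _ xs p] s p xs by fastforce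
    qed auto
    finally show ?thesis .
  qed

  define N where "N = real n"
  have N: "N \<ge> 25" using n2 by (simp add: N_def)
  have scale: "(\<Sum>xs\<in>L. real (card {p \<in> {1..n}. \<forall>x\<in>set xs. box s x \<noteq> box s p}))
      \<le> N ^ m * min N (4 * N ^ 3 / real m / (real s)\<^sup>2)" if s: "s \<in> {1..n - 1}" for s
  proof -
    have "card {p \<in> {1..n}. \<forall>x\<in>set xs. box s x \<noteq> box s p} \<le> n" for xs
      by (rule order_trans[OF card_mono[of "{1..n}"]]) auto
    then have "(\<Sum>xs\<in>L. real (card {p \<in> {1..n}. \<forall>x\<in>set xs. box s x \<noteq> box s p})) \<le> (\<Sum>xs\<in>L. N)"
      unfolding N_def by (intro sum_mono of_nat_mono)
    also have "\<dots> = N ^ m * N" unfolding L by (simp add: card_lists_length_eq N_def)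
    finally have 1: "(\<Sum>xs\<in>L. real (card {p \<in> {1..n}. \<forall>x\<in>set xs. box s x \<noteq> box s p})) \<le> N ^ m * N" .
    have "real ((n - 1) div s + 1) \<le> real (n - 1) / real s + 1" using of_nat_div_le_of_nat[of "n - 1" s] by simp
    also have "\<dots> = real (n - 1 + s) / real s" using s by (simp add: add_divide_distrib)
    also have "\<dots> \<le> 2 * N / real s" using s by (intro divide_right_mono) (auto simp: N_def)
    finally have "real ((n - 1) div s + 1) ^ 2 \<le> (2 * N / real s)\<^sup>2" by (intro power_mono) auto
    moreover have "real (card (box s ` {1..n})) \<le> real ((n - 1) div s + 1) ^ 2"
    proof -
      have "box s = (\<lambda>x. ((x - 1) div s, (\<pi> x - 1) div s))" by (simp add: box_def fun_eq_iff)
      then have "card (box s ` {1..n}) \<le> ((n - 1) div s + 1)\<^sup>2" using card_boxes_le[OF pi, of s] by simp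
      then have "real (card (box s ` {1..n})) \<le> real (((n - 1) div s + 1)\<^sup>2)" by (rule of_nat_mono)
      then show ?thesis by (simp only: of_nat_power)
    qed
    ultimately have "real (card (box s ` {1..n})) \<le> 4 * N\<^sup>2 / (real s)\<^sup>2"
      by (simp add: power_divide power_mult_distrib)
    then have "N ^ m * (N * real (card (box s ` {1..n})) / real m)
        \<le> N ^ m * (N * (4 * N\<^sup>2 / (real s)\<^sup>2) / real m)"
      using N by (intro mult_left_mono divide_right_mono) auto
    also have "N * (4 * N\<^sup>2 / (real s)\<^sup>2) / real m = 4 * N ^ 3 / real m / (real s)\<^sup>2"
      by (simp add: power2_eq_square power3_eq_cube ac_simps)
    finally have 2: "N ^ m * (N * real (card (box s ` {1..n})) / real m)
        \<le> N ^ m * (4 * N ^ 3 / real m / (real s)\<^sup>2)" .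
    have "(\<Sum>xs\<in>L. real (card {p \<in> {1..n}. \<forall>x\<in>set xs. box s x \<noteq> box s p}))
        \<le> N ^ m * (4 * N ^ 3 / real m / (real s)\<^sup>2)"
      using sum_card_missed_le[OF _ m1 L, of "box s"] n2 2 unfolding N_def by linarith
    with 1 show ?thesis by (simp add: min_def)
  qed

  define k where "k = nat \<lceil>\<epsilon> * N / 50\<rceil>"
  have "\<epsilon> * N / 50 > 0" using \<epsilon> N by simp
  then have k: "real k \<ge> \<epsilon> * N / 50" "real k \<le> \<epsilon> * N / 50 + 1" "k \<ge> 1" unfolding k_def by linarith+
  have "sum Z L \<le> (\<Sum>xs\<in>L. \<Sum>s\<in>{1..n - 1}. real (card {p \<in> {1..n}. \<forall>x\<in>set xs. box s x \<noteq> box s p}))"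
    by (rule sum_mono[OF Z_le])
  also have "\<dots> = (\<Sum>s\<in>{1..n - 1}. \<Sum>xs\<in>L. real (card {p \<in> {1..n}. \<forall>x\<in>set xs. box s x \<noteq> box s p}))"
    by (rule sum.swap)
  also have "\<dots> \<le> (\<Sum>s\<in>{1..n - 1}. N ^ m * min N (4 * N ^ 3 / real m / (real s)\<^sup>2))"
    by (rule sum_mono[OF scale])
  also have "\<dots> = N ^ m * (\<Sum>s\<in>{1..n - 1}. min N (4 * N ^ 3 / real m / (real s)\<^sup>2))"
    by (simp add: sum_distrib_left)
  also have "\<dots> \<le> N ^ m * (N * real k + 4 * N ^ 3 / real m / real k)"
    using N k by (intro mult_left_mono sum_min_inverse_square_le) auto
  finally have sumZ: "sum Z L \<le> N ^ m * (N * real k + 4 * N ^ 3 / real m / real k)" .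

  define c where "c = real (n choose 2)"
  have c: "c = N * (N - 1) / 2"
  proof -
    have "2 dvd n * (n - 1)" by (cases "even n") auto
    then have "2 * (n choose 2) = n * (n - 1)" unfolding choose_two by (rule dvd_mult_div_cancel)
    then have "2 * c = real (n * (n - 1))" unfolding c_def by (metis of_nat_mult of_nat_numeral)
    then show ?thesis using n2 by (simp add: N_def of_nat_diff)
  qed
  have c0: "c > 0" using N by (simp add: c)
  have "N * real k + 4 * N ^ 3 / real m / real k \<le> \<epsilon> * c / 12"
  proof -
    have "10000 / \<epsilon>\<^sup>2 * (\<epsilon> * N / 50) \<le> real m * real k"
      using m k \<epsilon> N by (intro mult_mono) auto
    moreover have "10000 / \<epsilon>\<^sup>2 * (\<epsilon> * N / 50) = 200 * N / \<epsilon>" using \<epsilon> by (simp add: power2_eq_square)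
    ultimately have "4 * N ^ 3 / (real m * real k) \<le> 4 * N ^ 3 / (200 * N / \<epsilon>)"
      using \<epsilon> N m1 k by (intro divide_left_mono) auto
    also have "\<dots> = \<epsilon> * N\<^sup>2 / 50" using N \<epsilon> by (simp add: power2_eq_square power3_eq_cube)
    finally have "4 * N ^ 3 / real m / real k \<le> \<epsilon> * N\<^sup>2 / 50" by simp
    moreover have "N * real k \<le> N * (\<epsilon> * N / 50 + 1)" using k N by (intro mult_left_mono) auto
    moreover have "(600 / \<epsilon> + 25) * (\<epsilon> * N) \<le> N * (\<epsilon> * N)"
      using n \<epsilon> N by (intro mult_right_mono) (auto simp: N_def)
    moreover have "(600 / \<epsilon> + 25) * (\<epsilon> * N) = 600 * N + 25 * (\<epsilon> * N)" using \<epsilon> by (simp add: algebra_simps)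
    ultimately show ?thesis by (simp add: c power2_eq_square algebra_simps)
  qed
  then have "N ^ m * (N * real k + 4 * N ^ 3 / real m / real k) \<le> N ^ m * (\<epsilon> * c / 12)"
    using N by (intro mult_left_mono) auto
  with sumZ have sumZ': "sum Z L \<le> N ^ m * (\<epsilon> * c / 12)" by linarith

  have "{xs \<in> L. accepts P M (set xs) \<pi>} \<subseteq> {xs \<in> L. \<epsilon> * c / 4 < Z xs}"
  proof clarify
    fix xs assume xs: "xs \<in> L" and acc: "accepts P M (set xs) \<pi>"
    have "\<epsilon> < dist_PT P n \<pi>" using far by (simp add: far_PT_def)
    also have "\<dots> \<le> real (\<Sum>p\<in>{1..n}. 2 * nat \<bar>int (f xs p) - int p\<bar>
        + 2 * nat \<bar>int (\<pi> (f xs p)) - int (\<pi> p)\<bar>) / c"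
      unfolding c_def using f[OF xs] n2 by (intro dist_PT_le_assignment[OF P perm _ acc]) auto
    also have "\<dots> \<le> real (\<Sum>p\<in>{1..n}. 4 * d (f xs p) p) / c"
      using c0 by (intro divide_right_mono of_nat_mono sum_mono) (auto simp: d_def)
    also have "\<dots> = 4 * Z xs / c" by (simp add: Z_def sum_distrib_left)
    finally show "\<epsilon> * c / 4 < Z xs" using c0 by (simp add: field_simps)
  qed
  then have "card {xs \<in> L. accepts P M (set xs) \<pi>} \<le> card {xs \<in> L. \<epsilon> * c / 4 < Z xs}"
    using fin by (intro card_mono) auto
  then have "\<epsilon> * c / 4 * real (card {xs \<in> L. accepts P M (set xs) \<pi>})
      \<le> \<epsilon> * c / 4 * real (card {xs \<in> L. \<epsilon> * c / 4 < Z xs})"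
    using c0 \<epsilon> by (intro mult_left_mono) auto
  also have "\<dots> \<le> sum Z L" by (rule markov_card[OF fin]) (auto simp: Z_def intro!: sum_nonneg)
  also have "\<dots> \<le> \<epsilon> * c / 4 * (N ^ m / 3)" using sumZ' by (simp add: ac_simps)
  finally have "real (card {xs \<in> L. accepts P M (set xs) \<pi>}) \<le> N ^ m / 3"
    using c0 \<epsilon> by (simp add: mult_le_cancel_left_pos)
  then have "real (3 * card {xs \<in> L. accepts P M (set xs) \<pi>}) \<le> real (n ^ m)" by (simp add: N_def)
  then show ?thesis by linarith
qed

section \<open>Rich boxes and blow-ups\<close>

lemma finite_k_star_set: "finite {k_star_perm P T \<alpha> |\<alpha>. (T, \<alpha>) \<in> permutations \<and> k_star_perm P T \<alpha> < \<infinity>}"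
  by (rule finite_subset[OF _ finite_imageI[OF finite_permutations_length[of T], of "k_star_perm P T"]]) auto

lemma k_star_perm_le_k_star:
  assumes "(T, \<alpha>) \<in> permutations" "k_star_perm P T \<alpha> \<noteq> \<infinity>"
  shows "k_star_perm P T \<alpha> \<le> k_star P T"
  using assms finite_k_star_set[of P T] unfolding k_star_def Let_def
  by (auto intro!: Max_ge)

lemma k_star_pos:
  assumes "k_star P T = enat k"
  shows "k \<ge> 1"
proof -
  let ?S = "{k_star_perm P T \<alpha> |\<alpha>. (T, \<alpha>) \<in> permutations \<and> k_star_perm P T \<alpha> < \<infinity>}"
  have "?S \<noteq> {}" "enat k = Max ?S" using assms unfolding k_star_def Let_def by (auto split: if_splits)
  then have "enat k \<in> ?S" using Max_in[OF finite_k_star_set[of P T]] by simp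
  then obtain \<alpha> where "k_star_perm P T \<alpha> = enat k" by auto
  then have ex: "\<exists>k\<ge>1. no_k_blow_up_in P k T \<alpha>" "k = (LEAST k. k \<ge> 1 \<and> no_k_blow_up_in P k T \<alpha>)"
    unfolding k_star_perm_def by (auto split: if_splits)
  then show ?thesis using LeastI_ex[OF ex(1)] by simp
qed

lemma block_index_unique:
  fixes a b i k :: nat
  assumes "1 + (a - 1) * k \<le> i" "i < 1 + a * k" "1 + (b - 1) * k \<le> i" "i < 1 + b * k" "a \<ge> 1" "b \<ge> 1"
  shows "a = b"
proof -
  have "(i - 1) div k = a - 1" using assms by (intro div_nat_eqI) (auto simp: mult.commute)
  moreover have "(i - 1) div k = b - 1" using assms by (intro div_nat_eqI) (auto simp: mult.commute)
  ultimately show ?thesis using assms(5,6) by linarith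
qed

lemma k_star_perm_pattern_infinite:
  assumes hered: "hereditary P" and \<pi>: "(n, \<pi>) \<in> P" "\<pi> permutes {1..n}" and f: "mono f"
    and X: "X \<subseteq> {1..n}" "X \<noteq> {}" "inj_on f X" "inj_on (\<lambda>x. f (\<pi> x)) X"
    and rich: "\<And>x. x \<in> X \<Longrightarrow> k \<le> card {y \<in> {1..n}. f y = f x \<and> f (\<pi> y) = f (\<pi> x)}"
    and k: "k_star P (card X) = enat k"
    and \<beta>: "(card X, \<beta>) \<in> permutations" "\<And>x. x \<in> X \<Longrightarrow> \<beta> (rank_in (\<lambda>x. x) X x) = rank_in \<pi> X x"
  shows "k_star_perm P (card X) \<beta> = \<infinity>"
proof (rule ccontr)
  define M where "M = card X"
  have finX: "finite X" using X finite_subset by blast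
  assume *: "k_star_perm P (card X) \<beta> \<noteq> \<infinity>"
  then have ex: "\<exists>k\<ge>1. no_k_blow_up_in P k M \<beta>"
    unfolding k_star_perm_def M_def by (auto split: if_splits)
  define k' where "k' = (LEAST k. k \<ge> 1 \<and> no_k_blow_up_in P k M \<beta>)"
  have k': "k' \<ge> 1" "no_k_blow_up_in P k' M \<beta>" using LeastI_ex[OF ex] by (simp_all add: k'_def)
  have "k_star_perm P M \<beta> = enat k'" using ex by (simp add: k_star_perm_def k'_def)
  then have "k' \<le> k" using k_star_perm_le_k_star[OF \<beta>(1) *] k by (simp add: M_def)
  then have "\<forall>x\<in>X. \<exists>Z. Z \<subseteq> {y \<in> {1..n}. f y = f x \<and> f (\<pi> y) = f (\<pi> x)} \<and> card Z = k' \<and> finite Z"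
    using rich by (meson obtain_subset_with_card_n order_trans)
  from bchoice[OF this] obtain Z
    where Z': "\<forall>x\<in>X. Z x \<subseteq> {y \<in> {1..n}. f y = f x \<and> f (\<pi> y) = f (\<pi> x)} \<and> card (Z x) = k' \<and> finite (Z x)" ..
  have Z: "\<And>x. x \<in> X \<Longrightarrow> Z x \<subseteq> {y \<in> {1..n}. f y = f x \<and> f (\<pi> y) = f (\<pi> x)}"
      "\<And>x. x \<in> X \<Longrightarrow> card (Z x) = k'" "\<And>x. x \<in> X \<Longrightarrow> finite (Z x)"
    using Z' by blast+
  have fZ: "f z = f x" "f (\<pi> z) = f (\<pi> x)" if "x \<in> X" "z \<in> Z x" for x z using Z(1)[OF that(1)] that(2) by auto
  have order: "f x < f y" if "x \<in> X" "y \<in> X" "x < y" for x y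
    using monoD[OF f, of x y] inj_onD[OF X(3), of x y] that by force
  have disj: "Z x \<inter> Z y = {}" if "x \<in> X" "y \<in> X" "x \<noteq> y" for x y
  proof (rule ccontr)
    assume "Z x \<inter> Z y \<noteq> {}"
    then obtain z where "z \<in> Z x" "z \<in> Z y" by blast
    then have "f x = f y" using fZ(1)[of x z] fZ(1)[of y z] that by simp
    then show False using inj_onD[OF X(3)] that by blast
  qed
  have cardZ: "card (\<Union>x\<in>Y. Z x) = card Y * k'" if "Y \<subseteq> X" for Y
  proof -
    have "card (\<Union>x\<in>Y. Z x) = (\<Sum>x\<in>Y. card (Z x))"
      using that Z(3) disj finite_subset[OF that finX] by (intro card_UN_disjoint) blast+
    then show ?thesis using that Z(2) by (simp add: subset_iff)
  qed
  define W where "W = (\<Union>x\<in>X. Z x)"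
  have W: "finite W" "W \<subseteq> {1..n}" "card W = M * k'"
  proof -
    show "finite W" using Z(3) finX by (auto simp: W_def)
    show "W \<subseteq> {1..n}" unfolding W_def using Z(1) by blast
    show "card W = M * k'" using cardZ[of X] by (simp add: W_def M_def)
  qed
  have "M \<ge> 1" using X(2) finX by (simp add: M_def Suc_leI card_gt_0_iff)
  then have "W \<noteq> {}" using W(3) k' by auto
  have inj\<pi>: "inj_on \<pi> A" for A using permutes_inj[OF \<pi>(2)] by (rule inj_on_subset) simp
  obtain \<gamma> where \<gamma>: "(card W, \<gamma>) \<in> permutations"
    and rk: "\<And>z. z \<in> W \<Longrightarrow> \<gamma> (rank_in (\<lambda>x. x) W z) = rank_in \<pi> W z"
    using pattern_exists[OF W(1) \<open>W \<noteq> {}\<close> inj\<pi>] by metis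
  have \<gamma>P: "(card W, \<gamma>) \<in> P" by (rule hereditary_pattern[OF hered \<pi>(1) W(2) \<gamma> rk])
  define e where "e = rank_in (\<lambda>x. x) X"
  have e: "e x \<in> {1..M}" if "x \<in> X" for x
    using bij_betwE[OF bij_betw_rank_in[OF finX, of "\<lambda>x. x"]] that by (auto simp: e_def M_def)
  have rank: "1 + (e x - 1) * k' \<le> rank_in (\<lambda>x. x) W z" "rank_in (\<lambda>x. x) W z < 1 + e x * k'"
    if x: "x \<in> X" and z: "z \<in> Z x" for x z
  proof -
    have "{y \<in> W. y \<le> z} \<subseteq> (\<Union>x'\<in>{x' \<in> X. x' \<le> x}. Z x')"
    proof
      fix y assume y: "y \<in> {y \<in> W. y \<le> z}"
      then obtain x' where x': "x' \<in> X" "y \<in> Z x'" by (auto simp: W_def)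
      have "f x' \<le> f x" using monoD[OF f, of y z] y fZ(1)[OF x z] fZ(1)[OF x'] by simp
      then have "x' \<le> x" using order[OF x x'(1)] by (meson leD not_le_imp_less)
      then show "y \<in> (\<Union>x'\<in>{x' \<in> X. x' \<le> x}. Z x')" using x' by blast
    qed
    then have "card {y \<in> W. y \<le> z} \<le> card (\<Union>x'\<in>{x' \<in> X. x' \<le> x}. Z x')"
      using Z(3) finX by (intro card_mono) auto
    also have "\<dots> = e x * k'" using cardZ[of "{x' \<in> X. x' \<le> x}"] by (simp add: e_def rank_in_def)
    finally show "rank_in (\<lambda>x. x) W z < 1 + e x * k'" by (simp add: rank_in_def)
    have lt: "y < z" if "x' \<in> X" "x' < x" "y \<in> Z x'" for x' y
    proof (rule ccontr)
      assume "\<not> y < z"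
      then have "f z \<le> f y" using monoD[OF f, of z y] by simp
      then show False using order[OF that(1) x that(2)] fZ(1)[OF x z] fZ(1)[OF that(1,3)] by simp
    qed
    have "insert z (\<Union>x'\<in>{x' \<in> X. x' < x}. Z x') \<subseteq> {y \<in> W. y \<le> z}"
      using lt x z unfolding W_def by (auto intro: less_imp_le)
    then have "card (insert z (\<Union>x'\<in>{x' \<in> X. x' < x}. Z x')) \<le> card {y \<in> W. y \<le> z}"
      using W(1) by (intro card_mono) auto
    moreover have "z \<notin> (\<Union>x'\<in>{x' \<in> X. x' < x}. Z x')" using lt by blast
    moreover have "finite (\<Union>x'\<in>{x' \<in> X. x' < x}. Z x')" using Z(3) finX by auto
    moreover have "card (\<Union>x'\<in>{x' \<in> X. x' < x}. Z x') = (e x - 1) * k'"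
    proof -
      have "{x' \<in> X. x' \<le> x} = insert x {x' \<in> X. x' < x}" using x by auto
      then have "e x - 1 = card {x' \<in> X. x' < x}" using finX by (simp add: e_def rank_in_def)
      then show ?thesis using cardZ[of "{x' \<in> X. x' < x}"] by simp
    qed
    ultimately show "1 + (e x - 1) * k' \<le> rank_in (\<lambda>x. x) W z" by (simp add: rank_in_def)
  qed
  have surj: "\<exists>x\<in>X. \<exists>z\<in>Z x. z \<in> W \<and> rank_in (\<lambda>x. x) W z = i \<and> e x = j"
    if j: "j \<in> {1..M}" and i: "i \<in> {1 + (j - 1) * k'..<1 + j * k'}" for i j
  proof -
    have "j * k' \<le> M * k'" using j by simp
    then have "1 \<le> i" "i \<le> M * k'" using i unfolding atLeastLessThan_iff by linarith+
    then have "i \<in> rank_in (\<lambda>x. x) W ` W"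
      using bij_betw_imp_surj_on[OF bij_betw_rank_in[OF W(1), of "\<lambda>x. x"]] W(3) by simp
    then obtain z where z: "z \<in> W" "rank_in (\<lambda>x. x) W z = i" by blast
    then obtain x where x: "x \<in> X" "z \<in> Z x" by (auto simp: W_def)
    have "e x = j" using rank[OF x] e[OF x(1)] z(2) i j by (intro block_index_unique[of _ k' i]) auto
    with x z show ?thesis by blast
  qed
  define K where "K j = 1 + (j - 1) * k'" for j
  have "blow_up_with K M \<beta> (card W) \<gamma>"
    unfolding blow_up_with_def
  proof (intro conjI ballI impI)
    show "K 1 = 1" by (simp add: K_def)
    show "K (M + 1) = card W + 1" by (simp add: K_def W)
    show "strict_mono_on {1..M + 1} K"
      using k' by (intro strict_mono_onI) (auto simp: K_def)
    fix j1 j2 i1 i2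
    assume j: "j1 \<in> {1..M}" "j2 \<in> {1..M}" and "i1 \<in> {K j1..<K (j1 + 1)}" "i2 \<in> {K j2..<K (j2 + 1)}"
      and "j1 \<noteq> j2"
    then obtain x1 z1 x2 z2 where x: "x1 \<in> X" "e x1 = j1" "x2 \<in> X" "e x2 = j2"
      and z: "z1 \<in> Z x1" "z1 \<in> W" "rank_in (\<lambda>x. x) W z1 = i1" "z2 \<in> Z x2" "z2 \<in> W" "rank_in (\<lambda>x. x) W z2 = i2"
      using surj[OF j(1), of i1] surj[OF j(2), of i2] unfolding K_def by auto
    have ne: "f (\<pi> x1) \<noteq> f (\<pi> x2)" using inj_onD[OF X(4) _ x(1,3)] x \<open>j1 \<noteq> j2\<close> by blast
    have "\<gamma> i1 > \<gamma> i2 \<longleftrightarrow> \<pi> z1 > \<pi> z2"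
      using rk[OF z(2)] rk[OF z(5)] rank_in_less_iff[OF W(1) z(5,2), of \<pi>] z by simp
    also have "\<dots> \<longleftrightarrow> f (\<pi> x1) > f (\<pi> x2)"
      using fZ(2)[OF x(1) z(1)] fZ(2)[OF x(3) z(4)] ne monoD[OF f, of "\<pi> z1" "\<pi> z2"] monoD[OF f, of "\<pi> z2" "\<pi> z1"]
      by (cases "\<pi> z1 \<le> \<pi> z2") auto
    also have "\<dots> \<longleftrightarrow> \<pi> x1 > \<pi> x2"
      using ne monoD[OF f, of "\<pi> x1" "\<pi> x2"] monoD[OF f, of "\<pi> x2" "\<pi> x1"]
      by (cases "\<pi> x1 \<le> \<pi> x2") auto
    also have "\<dots> \<longleftrightarrow> \<beta> j1 > \<beta> j2"
      using \<beta>(2)[OF x(1)] \<beta>(2)[OF x(3)] rank_in_less_iff[OF finX x(3,1), of \<pi>] x by (simp add: e_def)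
    finally show "\<gamma> i1 > \<gamma> i2 \<longleftrightarrow> \<beta> j1 > \<beta> j2" .
  qed
  moreover have "\<forall>j\<in>{1..M}. K (j + 1) - K j = k'"
  proof
    fix j assume "j \<in> {1..M}"
    then show "K (j + 1) - K j = k'" by (cases j) (auto simp: K_def)
  qed
  ultimately have "k_blow_up k' M \<beta> (card W) \<gamma>" unfolding k_blow_up_def by blast
  then show False using k'(2) \<gamma> \<gamma>P unfolding no_k_blow_up_in_def by blast
qed

definition good_list :: "nat set \<Rightarrow> (nat \<Rightarrow> nat) \<Rightarrow> (nat \<Rightarrow> nat) \<Rightarrow> nat list \<Rightarrow> bool" where
  "good_list R g h xs \<longleftrightarrow> set xs \<subseteq> R \<and> distinct (map g xs) \<and> distinct (map h xs)"

lemma card_good_extensions: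
  assumes "finite R" "\<And>c. card {x \<in> R. g x = c} \<le> w" "\<And>c. card {x \<in> R. h x = c} \<le> w"
    and "good_list R g h xs"
  shows "card R \<le> card {x. good_list R g h (x # xs)} + 2 * w * length xs"
proof -
  let ?E = "{x. good_list R g h (x # xs)}"
  let ?U = "\<Union>y\<in>set xs. {x \<in> R. g x = g y} \<union> {x \<in> R. h x = h y}"
  have E: "finite ?E" by (rule finite_subset[OF _ assms(1)]) (auto simp: good_list_def)
  have "R \<subseteq> ?E \<union> ?U" using assms(4) by (auto simp: good_list_def)
  then have "card R \<le> card ?E + card ?U"
    using E assms(1) by (intro order_trans[OF card_mono card_Un_le]) auto
  also have "card ?U \<le> (\<Sum>y\<in>set xs. 2 * w)"
  proof (rule order_trans[OF card_UN_le sum_mono])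
    fix y
    show "card ({x \<in> R. g x = g y} \<union> {x \<in> R. h x = h y}) \<le> 2 * w"
      using card_Un_le[of "{x \<in> R. g x = g y}" "{x \<in> R. h x = h y}"] assms(2)[of "g y"] assms(3)[of "h y"]
      by linarith
  qed simp
  also have "\<dots> \<le> 2 * w * length xs" using card_length[of xs] by simp
  finally show ?thesis by simp
qed

lemma card_good_lists_ge:
  assumes "finite R" "\<And>c. card {x \<in> R. g x = c} \<le> w" "\<And>c. card {x \<in> R. h x = c} \<le> w"
    and "j \<le> m"
  shows "(card R - 2 * w * m) ^ j \<le> card {xs. good_list R g h xs \<and> length xs = j}"
  using assms(4)
proof (induction j)
  case 0
  have "{xs. good_list R g h xs \<and> length xs = 0} = {[]}" by (auto simp: good_list_def)
  then show ?case by simp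
next
  case (Suc j)
  let ?G = "\<lambda>j. {xs. good_list R g h xs \<and> length xs = j}"
  have fin: "finite (?G j)" for j
    by (rule finite_subset[OF _ finite_lists_length_eq[OF assms(1), of j]]) (auto simp: good_list_def)
  have finE: "finite {x. good_list R g h (x # xs)}" for xs
    by (rule finite_subset[OF _ assms(1)]) (auto simp: good_list_def)
  have "?G (Suc j) = (\<lambda>(xs, x). x # xs) ` (SIGMA xs:?G j. {x. good_list R g h (x # xs)})"
    by (auto simp: length_Suc_conv image_iff good_list_def)
  moreover have "inj_on (\<lambda>(xs, x). x # xs) A" for A :: "(nat list \<times> nat) set"
    by (auto simp: inj_on_def)
  ultimately have "card (?G (Suc j)) = card (SIGMA xs:?G j. {x. good_list R g h (x # xs)})"
    by (simp add: card_image)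
  also have "\<dots> = (\<Sum>xs\<in>?G j. card {x. good_list R g h (x # xs)})"
    using fin finE by (intro card_SigmaI) auto
  also have "\<dots> \<ge> (\<Sum>xs\<in>?G j. card R - 2 * w * m)"
  proof (rule sum_mono)
    fix xs assume xs: "xs \<in> ?G j"
    then have "2 * w * length xs \<le> 2 * w * m" using Suc.prems by simp
    moreover have "card R \<le> card {x. good_list R g h (x # xs)} + 2 * w * length xs"
      using xs by (intro card_good_extensions[OF assms(1-3)]) simp
    ultimately show "card R - 2 * w * m \<le> card {x. good_list R g h (x # xs)}" by linarith
  qed
  finally have "card (?G j) * (card R - 2 * w * m) \<le> card (?G (Suc j))" by simp
  moreover have "(card R - 2 * w * m) ^ Suc j \<le> card (?G j) * (card R - 2 * w * m)"
    unfolding power_Suc2 using Suc by (intro mult_right_mono) auto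
  ultimately show ?case by (rule order_trans[rotated])
qed

lemma good_list_extend:
  assumes "finite R" "\<And>c. card {x \<in> R. g x = c} \<le> w" "\<And>c. card {x \<in> R. h x = c} \<le> w"
    and "good_list R g h xs" "length xs \<le> M" "2 * w * M < card R"
  shows "\<exists>zs. good_list R g h zs \<and> length zs = M \<and> set xs \<subseteq> set zs"
  using assms(4,5)
proof (induction "M - length xs" arbitrary: xs)
  case 0
  then show ?case by (intro exI[of _ xs]) auto
next
  case (Suc d)
  have "2 * w * length xs \<le> 2 * w * M" using Suc.prems by simp
  then have "card {x. good_list R g h (x # xs)} > 0"
    using card_good_extensions[OF assms(1-3) Suc.prems(1)] assms(6) by linarith
  then obtain x where "good_list R g h (x # xs)" by (auto simp: card_gt_0_iff)
  moreover have "d = M - length (x # xs)" "length (x # xs) \<le> M" using Suc.hyps(2) by auto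
  ultimately obtain zs where "good_list R g h zs \<and> length zs = M \<and> set (x # xs) \<subseteq> set zs"
    using Suc.hyps(1) by blast
  then show ?case by (intro exI[of _ zs]) auto
qed

lemma accepts_if_good_list:
  assumes "hereditary P" and \<pi>: "(n, \<pi>) \<in> P" "\<pi> permutes {1..n}" and f: "mono f"
    and R: "R = {x \<in> {1..n}. k \<le> card {y \<in> {1..n}. f y = f x \<and> f (\<pi> y) = f (\<pi> x)}}"
    and zs: "good_list R f (\<lambda>x. f (\<pi> x)) zs" "length zs = M" "M \<ge> 1"
    and k: "k_star P M = enat k" and S: "S \<subseteq> set zs"
  shows "accepts P M S \<pi>"
proof -
  define X where "X = set zs"
  have X: "X \<subseteq> R" "inj_on f X" "inj_on (\<lambda>x. f (\<pi> x)) X" "finite X" and dist: "distinct zs"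
    using zs by (auto simp: good_list_def X_def distinct_map)
  have XM: "card X = M" using dist zs(2) by (simp add: X_def distinct_card)
  have Xn: "X \<subseteq> {1..n}" "X \<noteq> {}" using X R XM zs(3) by auto
  have inj\<pi>: "inj_on \<pi> X" using permutes_inj[OF \<pi>(2)] by (rule inj_on_subset) simp
  obtain \<beta> where \<beta>: "(card X, \<beta>) \<in> permutations"
    and rk: "\<And>x. x \<in> X \<Longrightarrow> \<beta> (rank_in (\<lambda>x. x) X x) = rank_in \<pi> X x"
    using pattern_exists[OF X(4) Xn(2) inj\<pi>] by metis
  have "k_star_perm P (card X) \<beta> = \<infinity>"
    using X(1) R k XM by (intro k_star_perm_pattern_infinite[OF assms(1) \<pi> f Xn X(2,3) _ _ \<beta> rk]) auto
  moreover have "rank_in (\<lambda>x. x) X ` S \<subseteq> {1..M}"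
    using bij_betw_imp_surj_on[OF bij_betw_rank_in[OF X(4), of "\<lambda>x. x"]] S XM by (auto simp: X_def)
  moreover have "strict_mono_on S (rank_in (\<lambda>x. x) X)"
    using S rank_in_less_iff[OF X(4), of _ _ "\<lambda>x. x"] by (intro strict_mono_onI) (auto simp: X_def)
  moreover have "\<forall>x\<in>S. \<forall>y\<in>S. \<pi> x < \<pi> y \<longleftrightarrow> \<beta> (rank_in (\<lambda>x. x) X x) < \<beta> (rank_in (\<lambda>x. x) X y)"
    using S rk rank_in_less_iff[OF X(4), of _ _ \<pi>] by (auto simp: X_def subset_iff)
  ultimately show ?thesis using \<beta> XM unfolding accepts_def by blast
qed

lemma card_strip_le:
  fixes w :: nat
  assumes "w \<ge> 1"
  shows "card {x \<in> {1..n}. (x - 1) div w = c} \<le> w"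
proof -
  have "{x \<in> {1..n}. (x - 1) div w = c} \<subseteq> {c * w + 1..c * w + w}"
  proof
    fix x assume x: "x \<in> {x \<in> {1..n}. (x - 1) div w = c}"
    then have "c * w + (x - 1) mod w = x - 1" using div_mult_mod_eq[of "x - 1" w] by simp
    moreover have "(x - 1) mod w < w" "x \<ge> 1" using assms x by auto
    ultimately have "c * w + 1 \<le> x" "x \<le> c * w + w" by linarith+
    then show "x \<in> {c * w + 1..c * w + w}" by simp
  qed
  then show ?thesis using card_mono[of "{c * w + 1..c * w + w}"] by fastforce
qed

lemma card_sparse_le:
  fixes g :: "nat \<Rightarrow> 'a"
  assumes "finite X"
  shows "card {x \<in> X. \<not> k \<le> card {y \<in> X. g y = g x}} \<le> card (g ` X) * k"
proof -
  let ?Y = "{x \<in> X. \<not> k \<le> card {y \<in> X. g y = g x}}"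
  have "?Y \<subseteq> (\<Union>c\<in>g ` ?Y. {x \<in> X. g x = c})" by auto
  then have "card ?Y \<le> card (\<Union>c\<in>g ` ?Y. {x \<in> X. g x = c})" using assms by (intro card_mono) auto
  also have "\<dots> \<le> (\<Sum>c\<in>g ` ?Y. k)"
    using assms by (intro order_trans[OF card_UN_le sum_mono]) auto
  also have "\<dots> \<le> card (g ` X) * k"
    using assms by (auto intro!: mult_right_mono card_mono)
  finally show ?thesis .
qed

lemma card_rejects_le_if_in_property:
  assumes "hereditary P" and \<pi>: "(n, \<pi>) \<in> P" "\<pi> permutes {1..n}"
    and k: "k_star P M = enat k" and M: "M \<ge> 1000" and m: "m = (M + 1) div 2"
    and n: "n \<ge> 32 * M ^ 5 * k" and L: "L = {xs. set xs \<subseteq> {1..n} \<and> length xs = m}"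
  shows "3 * card {xs \<in> L. \<not> accepts P M (set xs) \<pi>} \<le> n ^ m"
proof -
  have k1: "k \<ge> 1" by (rule k_star_pos[OF k])
  have "32 * M ^ 5 * 1 \<le> 32 * M ^ 5 * k" using k1 by (intro mult_left_mono) auto
  then have nM: "n \<ge> 32 * M ^ 5" using n by linarith
  define w where "w = n div (3 * M\<^sup>2)"
  have "3 * M\<^sup>2 * (3 * M\<^sup>2) = 9 * M ^ 4" by (simp add: power2_eq_square power4_eq_xxxx)
  also have "\<dots> \<le> 32 * M ^ 5" using M power_increasing[of 4 5 M] by linarith
  finally have w_ge: "3 * M\<^sup>2 \<le> w" unfolding w_def using nM M by (subst less_eq_div_iff_mult_less_eq) auto
  have "0 < M\<^sup>2" using M by simp
  then have w1: "w \<ge> 1" using w_ge by linarith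
  have wn: "3 * M\<^sup>2 * w \<le> n" unfolding w_def by (rule times_div_less_eq_dividend)
  have "n < 3 * M\<^sup>2 * w + 3 * M\<^sup>2"
    unfolding w_def using \<open>0 < M\<^sup>2\<close> mod_less_divisor[of "3 * M\<^sup>2" n] mult_div_mod_eq[of "3 * M\<^sup>2" n] by linarith
  then have "n < (3 * M\<^sup>2 + 1) * w" using w_ge by (simp add: algebra_simps)
  then have strips: "(n - 1) div w \<le> 3 * M\<^sup>2" using w1
    less_mult_imp_div_less[of "n - 1" "3 * M\<^sup>2 + 1" w] by linarith

  define f where "f x = (x - 1) div w" for x
  define R where "R = {x \<in> {1..n}. k \<le> card {y \<in> {1..n}. f y = f x \<and> f (\<pi> y) = f (\<pi> x)}}"
  have f: "mono f" unfolding f_def by (intro monoI div_le_mono diff_le_mono)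
  have finR: "finite R" by (simp add: R_def)
  have col: "card {x \<in> R. f x = c} \<le> w" for c
  proof -
    have "card {x \<in> R. f x = c} \<le> card {x \<in> {1..n}. (x - 1) div w = c}"
      by (intro card_mono) (auto simp: R_def f_def)
    then show ?thesis using card_strip_le[OF w1, of n c] by linarith
  qed
  have row: "card {x \<in> R. f (\<pi> x) = c} \<le> w" for c
  proof -
    have "card {x \<in> R. f (\<pi> x) = c} \<le> card {x \<in> {1..n}. (x - 1) div w = c}"
      using permutes_in_image[OF \<pi>(2)]
      by (intro card_inj_on_le[of \<pi>] inj_on_subset[OF permutes_inj[OF \<pi>(2)]]) (auto simp: R_def f_def)
    then show ?thesis using card_strip_le[OF w1, of n c] by linarith
  qed

  define sparse where "sparse = card {x \<in> {1..n}. \<not> k \<le> card {y \<in> {1..n}. (f y, f (\<pi> y)) = (f x, f (\<pi> x))}}"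
  have "sparse \<le> card ((\<lambda>x. (f x, f (\<pi> x))) ` {1..n}) * k"
    unfolding sparse_def
    by (rule card_sparse_le[where g = "\<lambda>x. (f x, f (\<pi> x))" and X = "{1..n}"]) simp
  also have "\<dots> \<le> (3 * M\<^sup>2 + 1)\<^sup>2 * k"
  proof (rule mult_right_mono)
    have "card ((\<lambda>x. (f x, f (\<pi> x))) ` {1..n}) \<le> ((n - 1) div w + 1)\<^sup>2"
      unfolding f_def by (rule card_boxes_le[OF \<pi>(2)])
    also have "\<dots> \<le> (3 * M\<^sup>2 + 1)\<^sup>2" using strips by (intro power_mono) auto
    finally show "card ((\<lambda>x. (f x, f (\<pi> x))) ` {1..n}) \<le> (3 * M\<^sup>2 + 1)\<^sup>2" .
  qed simp
  also have "\<dots> \<le> 10 * M ^ 4 * k"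
  proof (rule mult_right_mono)
    have "(3 * M\<^sup>2 + 1)\<^sup>2 = 9 * M ^ 4 + 6 * M\<^sup>2 + 1"
      by (simp add: power2_eq_square power4_eq_xxxx algebra_simps)
    moreover have "7 * M\<^sup>2 \<le> M\<^sup>2 * M\<^sup>2"
      using M power_increasing[of 1 2 M] by (intro mult_right_mono) auto
    moreover have "M\<^sup>2 * M\<^sup>2 = M ^ 4" by (simp add: power2_eq_square power4_eq_xxxx)
    ultimately show "(3 * M\<^sup>2 + 1)\<^sup>2 \<le> 10 * M ^ 4" using \<open>0 < M\<^sup>2\<close> by linarith
  qed simp
  finally have sparse: "sparse \<le> 10 * M ^ 4 * k" .
  have nR: "n \<le> card R + sparse"
  proof -
    have "{1..n} = R \<union> {x \<in> {1..n}. \<not> k \<le> card {y \<in> {1..n}. (f y, f (\<pi> y)) = (f x, f (\<pi> x))}}"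
      by (auto simp: R_def)
    from arg_cong[OF this, of card] show ?thesis
      using card_Un_le[of R "{x \<in> {1..n}. \<not> k \<le> card {y \<in> {1..n}. (f y, f (\<pi> y)) = (f x, f (\<pi> x))}}"]
      unfolding sparse_def card_atLeastAtMost by linarith
  qed

  define N x where "N = real n" and "x = real M"
  have x: "x \<ge> 1000" using M by (simp add: x_def)
  have N: "N \<ge> 32 * x ^ 5 * real k"
    using of_nat_mono[OF n, where ?'a = real] by (simp add: N_def x_def)
  have "0 < 32 * M ^ 5" using M by simp
  then have N0: "N > 0" using nM unfolding N_def by linarith
  have W: "real w \<le> N / (3 * x\<^sup>2)"
    using of_nat_mono[OF wn, where ?'a = real] x by (simp add: N_def x_def field_simps)
  have R: "real (card R) \<ge> N - 10 / 32 * N / x"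
  proof -
    have "10 * x ^ 4 * real k = 10 / 32 * (32 * x ^ 5 * real k) / x"
      using x by (simp add: field_simps eval_nat_numeral)
    also have "\<dots> \<le> 10 / 32 * N / x" using N x by (intro divide_right_mono mult_left_mono) auto
    finally have "10 * x ^ 4 * real k \<le> 10 / 32 * N / x" .
    moreover have "real sparse \<le> 10 * x ^ 4 * real k"
      using of_nat_mono[OF sparse, where ?'a = real] by (simp add: x_def)
    moreover have "N \<le> real (card R) + real sparse" using nR unfolding N_def by linarith
    ultimately show ?thesis by linarith
  qed
  have mx: "real m \<le> 501 / 1000 * x" using M unfolding m x_def by linarith
  have mM: "m \<le> M" "m \<ge> 1" using M by (auto simp: m)

  have "2 * w * M < card R"
  proof -
    have "2 * real w * x \<le> 2 * (N / (3 * x\<^sup>2)) * x" using W x by (intro mult_left_mono mult_right_mono) auto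
    also have "\<dots> = 2 / 3 * N / x" using x by (simp add: power2_eq_square)
    also have "\<dots> < N - 10 / 32 * N / x"
    proof -
      have "N / x * 1000 \<le> N / x * x" using x N0 by (intro mult_left_mono) auto
      then show ?thesis using x N0 by simp
    qed
    finally have "2 * real w * x < real (card R)" using R by linarith
    then have "real (2 * w * M) < real (card R)" by (simp add: x_def)
    then show ?thesis by (simp only: of_nat_less_iff)
  qed
  note extend = good_list_extend[OF finR col row _ _ this]

  define G where "G = {xs. good_list R f (\<lambda>x. f (\<pi> x)) xs \<and> length xs = m}"
  have GL: "G \<subseteq> L" by (auto simp: G_def L good_list_def R_def)
  have finL: "finite L" unfolding L by (rule finite_lists_length_eq) simp
  have "accepts P M (set xs) \<pi>" if xs: "xs \<in> G" for xs
  proof -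
    obtain zs where "good_list R f (\<lambda>x. f (\<pi> x)) zs" "length zs = M" "set xs \<subseteq> set zs"
      using extend[of xs] xs mM by (auto simp: G_def)
    then show ?thesis using M by (intro accepts_if_good_list[OF assms(1) \<pi> f R_def _ _ _ k]) auto
  qed
  then have "{xs \<in> L. \<not> accepts P M (set xs) \<pi>} \<subseteq> L - G" by auto
  then have "card {xs \<in> L. \<not> accepts P M (set xs) \<pi>} \<le> card (L - G)"
    using finL by (intro card_mono) auto
  then have "card {xs \<in> L. \<not> accepts P M (set xs) \<pi>} \<le> card L - card G"
    using card_Diff_subset[OF finite_subset[OF GL finL] GL] by simp
  moreover have "card L = n ^ m" unfolding L by (subst card_lists_length_eq) auto
  moreover have "card G \<le> card L" using finL GL by (intro card_mono)
  moreover have "real (card G) \<ge> N ^ m * (2 / 3)"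
  proof -
    define \<delta> where "\<delta> = 13 / 20 / x"
    have \<delta>: "0 \<le> \<delta>" "\<delta> \<le> 1" using x by (auto simp: \<delta>_def)
    have "2 * real w * real m \<le> 2 * (N / (3 * x\<^sup>2)) * (501 / 1000 * x)"
      using W mx x N0 by (intro mult_mono) auto
    also have "\<dots> = 334 / 1000 * N / x" using x by (simp add: power2_eq_square)
    finally have "N * (1 - \<delta>) \<le> real (card R) - 2 * real w * real m"
      using R N0 x by (simp add: \<delta>_def field_simps)
    also have "\<dots> \<le> real (card R - 2 * w * m)" by (simp add: of_nat_diff_real)
    finally have "(N * (1 - \<delta>)) ^ m \<le> real (card R - 2 * w * m) ^ m"
      using \<delta> N0 by (intro power_mono) auto
    also have "\<dots> \<le> real (card G)"
      using of_nat_mono[OF card_good_lists_ge[OF finR col row order_refl[of m]], where ?'a = real]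
      unfolding G_def by (simp only: of_nat_power)
    finally have "N ^ m * (1 - \<delta>) ^ m \<le> real (card G)" by (simp add: power_mult_distrib)
    moreover have "2 / 3 \<le> (1 - \<delta>) ^ m"
    proof -
      have "real m * \<delta> \<le> 501 / 1000 * x * \<delta>" using mx \<delta> by (intro mult_right_mono)
      also have "\<dots> \<le> 1 / 3" using x by (simp add: \<delta>_def)
      finally show ?thesis using Bernoulli_inequality[of "- \<delta>" m] \<delta> by simp
    qed
    then have "N ^ m * (2 / 3) \<le> N ^ m * (1 - \<delta>) ^ m" using N0 by (intro mult_left_mono) auto
    ultimately show ?thesis by linarith
  qed
  moreover have "N ^ m = real (n ^ m)" by (simp add: N_def)
  ultimately show ?thesis by linarith
qed

section \<open>The tester\<close>

primrec query_all :: "nat list \<Rightarrow> (nat list \<Rightarrow> bool) \<Rightarrow> query_alg" where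
  "query_all [] g = Output (g [])"
| "query_all (x # xs) g = Query x (\<lambda>v. query_all xs (\<lambda>vs. g (v # vs)))"

lemma verdict_query_all [simp]: "verdict \<pi> (query_all xs g) = g (map \<pi> xs)"
  by (induction xs arbitrary: g) auto

lemma queries_query_all [simp]: "queries \<pi> (query_all xs g) = xs"
  by (induction xs arbitrary: g) auto

lemma accepts_cong:
  assumes "\<And>x. x \<in> S \<Longrightarrow> h x = h' x"
  shows "accepts P M S h \<longleftrightarrow> accepts P M S h'"
  using assms unfolding accepts_def by simp

definition tester :: "(nat \<times> perm) set \<Rightarrow> nat \<Rightarrow> nat \<Rightarrow> nat \<Rightarrow> query_alg pmf" where
  "tester P M m n = map_pmf
     (\<lambda>xs. query_all xs (\<lambda>ys. accepts P M (set xs) (\<lambda>x. the (map_of (zip xs ys) x))))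
     (pmf_of_set {xs. set xs \<subseteq> {1..n} \<and> length xs = m})"

lemma tester_correct:
  assumes "n \<ge> 1" and L: "L = {xs. set xs \<subseteq> {1..n} \<and> length xs = m}"
  shows "a \<in> set_pmf (tester P M m n) \<Longrightarrow> set (queries \<pi> a) \<subseteq> {1..n} \<and> length (queries \<pi> a) = m"
    and "3 * card {xs \<in> L. accepts P M (set xs) \<pi> \<noteq> b} \<le> n ^ m \<Longrightarrow>
      measure_pmf.prob (tester P M m n) {a. verdict \<pi> a = b} \<ge> 2 / 3"
proof -
  have fin: "finite L" unfolding L by (rule finite_lists_length_eq) simp
  have "replicate m 1 \<in> L" using assms(1) by (auto simp: L)
  then have ne: "L \<noteq> {}" by blast
  define alg where "alg = (\<lambda>xs. query_all xs (\<lambda>ys. accepts P M (set xs) (\<lambda>x. the (map_of (zip xs ys) x))))"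
  have t: "tester P M m n = map_pmf alg (pmf_of_set L)"
    unfolding tester_def alg_def L ..
  show "set (queries \<pi> a) \<subseteq> {1..n} \<and> length (queries \<pi> a) = m" if "a \<in> set_pmf (tester P M m n)"
    using that unfolding t set_map_pmf set_pmf_of_set[OF ne fin] by (auto simp: alg_def L)
  have v: "verdict \<pi> (alg xs) = accepts P M (set xs) \<pi>" for xs
    unfolding alg_def verdict_query_all by (rule accepts_cong) (simp add: map_of_zip_map)
  show "measure_pmf.prob (tester P M m n) {a. verdict \<pi> a = b} \<ge> 2 / 3"
    if "3 * card {xs \<in> L. accepts P M (set xs) \<pi> \<noteq> b} \<le> n ^ m"
  proof -
    define B where "B = {xs \<in> L. accepts P M (set xs) \<pi> \<noteq> b}"
    have "card L = n ^ m" unfolding L by (subst card_lists_length_eq) auto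
    then have "3 * card B \<le> card L" using that by (simp add: B_def)
    moreover have "card (L - B) = card L - card B"
      using fin by (intro card_Diff_subset) (auto simp: B_def)
    ultimately have "2 * real (card L) \<le> 3 * real (card (L - B))" by linarith
    moreover have "card L > 0" using fin ne by (simp add: card_gt_0_iff)
    ultimately have "2 / 3 \<le> real (card (L - B)) / real (card L)" by (simp add: field_simps)
    also have "L - B = L \<inter> alg -` {a. verdict \<pi> a = b}" by (auto simp: B_def v)
    also have "real (card (L \<inter> alg -` {a. verdict \<pi> a = b})) / real (card L)
        = measure_pmf.prob (tester P M m n) {a. verdict \<pi> a = b}"
      unfolding t measure_map_pmf measure_pmf_of_set[OF ne fin] by simp
    finally show ?thesis .
  qed
qed

theorem theorem1p8:
  fixes P :: "(nat \<times> perm) set" and \<epsilon> :: real and M :: nat and n\<^sub>0 :: ereal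
  assumes "permutation_property P"
    and "hereditary P"
    and "\<epsilon> > 0"
    and "M = nat \<lceil>20000 / \<epsilon>\<^sup>2\<rceil>"
    and "n\<^sub>0 = ereal (32 * real M ^ 5 / \<epsilon> ^ 3) * ereal_of_enat (k_star P M)"
  shows "\<exists>A. two_sided_tester P \<epsilon> M n\<^sub>0 A"
proof (cases "\<epsilon> \<ge> 1")
  case True
  have "\<not> far_PT \<epsilon> P n \<pi>" if "(n, \<pi>) \<in> permutations" for n \<pi>
    using dist_PT_le_1[OF assms(1) that] True by (simp add: far_PT_def)
  then have "two_sided_tester P \<epsilon> M n\<^sub>0 (\<lambda>_. return_pmf (Output True))"
    unfolding two_sided_tester_def by auto
  then show ?thesis by blast
next
  case False
  define x where "x = real M"
  have "\<epsilon>\<^sup>2 \<le> 1" using False assms(3) by (intro power_le_one) auto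
  then have "20000 \<le> 20000 / \<epsilon>\<^sup>2" using assms(3) by (simp add: le_divide_eq)
  then have x: "x \<ge> 20000 / \<epsilon>\<^sup>2" "x \<ge> 20000" unfolding x_def assms(4) by linarith+
  define m where "m = (M + 1) div 2"
  have mx: "real m \<ge> x / 2" "m \<le> M" using x unfolding m_def x_def by linarith+
  have m: "real m \<ge> 10000 / \<epsilon>\<^sup>2" using mx x(1) by simp
  have "(\<forall>a\<in>set_pmf (tester P M m n). set (queries \<pi> a) \<subseteq> {1..n} \<and> length (queries \<pi> a) \<le> M) \<and>
        ((n, \<pi>) \<in> P \<longrightarrow> measure_pmf.prob (tester P M m n) {a. verdict \<pi> a} \<ge> 2 / 3) \<and>
        (far_PT \<epsilon> P n \<pi> \<longrightarrow> measure_pmf.prob (tester P M m n) {a. \<not> verdict \<pi> a} \<ge> 2 / 3)"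
    if perm: "(n, \<pi>) \<in> permutations" and n0: "ereal (real n) \<ge> n\<^sub>0" for n \<pi>
  proof -
    have n1: "n \<ge> 1" and pi: "\<pi> permutes {1..n}" using perm by (auto simp: permutations_def)
    have c: "32 * x ^ 5 / \<epsilon> ^ 3 > 0" using x assms(3) by simp
    have "k_star P M \<noteq> \<infinity>"
    proof
      assume "k_star P M = \<infinity>"
      moreover have "ereal C * \<infinity> = \<infinity>" if "C > 0" for C using that by simp
      ultimately have "n\<^sub>0 = \<infinity>" using c by (simp only: assms(5) x_def ereal_of_enat_simps)
      then show False using n0 by simp
    qed
    then obtain k where k: "k_star P M = enat k" by auto
    have k1: "k \<ge> 1" by (rule k_star_pos[OF k])
    have n: "32 * x ^ 5 / \<epsilon> ^ 3 * real k \<le> real n" using n0 by (simp add: assms(5) k x_def)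
    have "\<epsilon> ^ 3 \<le> \<epsilon>" using power_decreasing[of 1 3 \<epsilon>] False assms(3) by simp
    then have "32 * x ^ 5 / \<epsilon> \<le> 32 * x ^ 5 / \<epsilon> ^ 3"
      using x assms(3) by (intro divide_left_mono) auto
    then have "32 * x ^ 5 / \<epsilon> * real k \<le> real n"
      using n by (meson mult_right_mono of_nat_0_le_iff order_trans)
    moreover have "32 * x ^ 5 * real k \<le> 32 * x ^ 5 / \<epsilon> * real k"
      using x False assms(3) by (intro mult_right_mono) (auto simp: le_divide_eq)
    moreover have "32 * x ^ 5 / \<epsilon> * 1 \<le> 32 * x ^ 5 / \<epsilon> * real k"
      using k1 x assms(3) by (intro mult_left_mono) auto
    moreover have "625 / \<epsilon> \<le> 32 * x ^ 5 / \<epsilon>"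
    proof (rule divide_right_mono)
      have "x ^ 1 \<le> x ^ 5" using x by (intro power_increasing) auto
      then show "625 \<le> 32 * x ^ 5" using x by simp
    qed (use assms(3) in simp)
    moreover have "600 / \<epsilon> + 25 \<le> 625 / \<epsilon>" using False assms(3) by (simp add: field_simps)
    ultimately have n_eps: "600 / \<epsilon> + 25 \<le> real n" and n_k: "32 * x ^ 5 * real k \<le> real n" by linarith+
    have "real (32 * M ^ 5 * k) \<le> real n" using n_k by (simp add: x_def)
    then have n_k: "32 * M ^ 5 * k \<le> n" by (simp only: of_nat_le_iff)
    have M: "M \<ge> 1000" using x(2) unfolding x_def by linarith
    show ?thesis
    proof (intro conjI impI ballI)
      fix a assume "a \<in> set_pmf (tester P M m n)"
      then show "set (queries \<pi> a) \<subseteq> {1..n}" "length (queries \<pi> a) \<le> M"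
        using tester_correct(1)[OF n1 refl] mx(2) by auto
    next
      assume "(n, \<pi>) \<in> P"
      from card_rejects_le_if_in_property[OF assms(2) this pi k M m_def n_k refl]
      show "measure_pmf.prob (tester P M m n) {a. verdict \<pi> a} \<ge> 2 / 3"
        using tester_correct(2)[OF n1 refl, of m P M \<pi> True] by simp
    next
      assume "far_PT \<epsilon> P n \<pi>"
      from card_accepts_le_if_far[OF assms(1,2) perm assms(3) _ m n_eps this refl, of M]
      show "measure_pmf.prob (tester P M m n) {a. \<not> verdict \<pi> a} \<ge> 2 / 3"
        using tester_correct(2)[OF n1 refl, of m P M \<pi> False] False by simp
    qed
  qed
  then have "two_sided_tester P \<epsilon> M n\<^sub>0 (tester P M m)"
    unfolding two_sided_tester_def by blast
  then show ?thesis by blast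
qed

end
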